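(* A class $\mathcal C$ of graphs satisfies $\mathcal C\sqsubseteq_{\mathrm{FO}}\mathcal P$ and $\mathcal P\sqsubseteq_{\mathrm{FO}}\mathcal C$ (i.e. $\mathcal C$ is FO transduction equivalent to the class $\mathcal P$ of all paths) if and only if $\mathcal C$ is a perturbation of a class with bounded bandwidth containing graphs with arbitrarily large connected components.
   Context: All graphs are finite, simple, undirected. A $\Sigma$-expansion of a graph $G$ ($\Sigma$ a finite set of unary symbols) is $G$ with a subset of $V(G)$ for each symbol. A simple interpretation $(\nu(x),\eta(x,y))$ of first-order formulas over $\{E\}\cup\Sigma$ ($\eta$ symmetric, antireflexive) produces from $G^+$ the graph on $\nu(G^+)$ with edges $uv$ where $G^+\models\eta(u,v)$. A non-copying transduction is a pair $(\Sigma,\mathsf I)$, producing from $G$ all $\mathsf I(G^+)$ over $\Sigma$-expansions $G^+$. The $k$-copy operation maps $G$ to $k$ disjoint copies of $G$ with copies of each vertex made pairwise adjacent. A transduction is a finite composition of copy operations and non-copying transductions. $\mathcal C\sqsubseteq_{\mathrm{FO}}\mathcal D$ means there is a transduction $\mathsf T$ such that every graph of $\mathcal C$ is obtained by $\mathsf T$ from some graph of $\mathcal D$. A class $\mathcal C$ is a perturbation of a class $\mathcal D$ if there is $k$ such that every graph of $\mathcal C$ is obtained from some graph of $\mathcal D$ by successively complementing the adjacency inside at most $k$ vertex subsets. The $\ell$-th power $P^\ell$ of a graph has the same vertices, two being adjacent iff at distance at most $\ell$. The bandwidth of $G$ is $\min\{\ell:$ there is a path $P$ with $P^\ell\supseteq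 G\}$ (subgraph containment). A class has bounded bandwidth if the bandwidth of its members is bounded. Classes are infinite.
   Formalization: "C is a perturbation of D" is taken in both directions: every graph of the bounded-bandwidth class D is also obtained from a graph of C by boundedly many complementations; otherwise C = edgeless graphs, D = edgeless graphs and all paths is a counterexample. *)

theory Defs
  imports "Graph_Theory.Graph_Theory"
begin

text \<open>
  Finite simple undirected graphs are the \<^emph>\<open>pair graphs\<close> of the library (locale \<^locale>\<open>pair_graph\<close>):
  finite, loop-free, with a symmetric set of ordered pairs as adjacency relation.  The graphs in a
  class have natural numbers as vertices, so that every finite graph occurs up to isomorphism;
  graphs are only ever distinguished up to isomorphism.
\<close>

type_synonym ngraph = "nat pair_pre_digraph"

abbreviation graph_iso :: "'a pair_pre_digraph \<Rightarrow> 'b pair_pre_digraph \<Rightarrow> bool" where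
  "graph_iso G H \<equiv> digraph_iso (with_proj G) (with_proj H)"

text \<open>Infinite means: infinitely many isomorphism types.\<close>

definition graph_class :: "ngraph set \<Rightarrow> bool" where
  "graph_class C \<longleftrightarrow> (\<forall>G\<in>C. pair_graph G) \<and>
     infinite (C // {(G, H). G \<in> C \<and> H \<in> C \<and> graph_iso G H})"


section \<open>First-order transductions\<close>

text \<open>Variables and unary predicate symbols are natural numbers; \<open>Pred s x\<close> is the atom \<open>s(x)\<close>.\<close>

datatype fo =
    Eq nat nat
  | Adj nat nat
  | Pred nat nat
  | Neg fo
  | Conj fo fo
  | Exists nat fo

primrec free_vars :: "fo \<Rightarrow> nat set" where
  "free_vars (Eq x y) = {x, y}"
| "free_vars (Adj x y) = {x, y}"
| "free_vars (Pred s x) = {x}"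
| "free_vars (Neg \<phi>) = free_vars \<phi>"
| "free_vars (Conj \<phi> \<psi>) = free_vars \<phi> \<union> free_vars \<psi>"
| "free_vars (Exists x \<phi>) = free_vars \<phi> - {x}"

primrec symbols :: "fo \<Rightarrow> nat set" where
  "symbols (Eq x y) = {}"
| "symbols (Adj x y) = {}"
| "symbols (Pred s x) = {s}"
| "symbols (Neg \<phi>) = symbols \<phi>"
| "symbols (Conj \<phi> \<psi>) = symbols \<phi> \<union> symbols \<psi>"
| "symbols (Exists x \<phi>) = symbols \<phi>"

text \<open>A \<open>\<Sigma>\<close>-expansion of \<open>G\<close> is \<open>G\<close> together with \<open>M\<close>; the values of \<open>M\<close> outside \<open>\<Sigma>\<close> are irrelevant.\<close>

definition expansion :: "nat set \<Rightarrow> 'a pair_pre_digraph \<Rightarrow> (nat \<Rightarrow> 'a set) \<Rightarrow> bool" where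
  "expansion \<Sigma> G M \<longleftrightarrow> (\<forall>s\<in>\<Sigma>. M s \<subseteq> pverts G)"

primrec sat :: "'a pair_pre_digraph \<Rightarrow> (nat \<Rightarrow> 'a set) \<Rightarrow> (nat \<Rightarrow> 'a) \<Rightarrow> fo \<Rightarrow> bool" where
  "sat G M a (Eq x y) \<longleftrightarrow> a x = a y"
| "sat G M a (Adj x y) \<longleftrightarrow> (a x, a y) \<in> parcs G"
| "sat G M a (Pred s x) \<longleftrightarrow> a x \<in> M s"
| "sat G M a (Neg \<phi>) \<longleftrightarrow> \<not> sat G M a \<phi>"
| "sat G M a (Conj \<phi> \<psi>) \<longleftrightarrow> sat G M a \<phi> \<and> sat G M a \<psi>"
| "sat G M a (Exists x \<phi>) \<longleftrightarrow> (\<exists>v\<in>pverts G. sat G M (a(x := v)) \<phi>)"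

text \<open>In \<open>\<nu>(x)\<close> and \<open>\<eta>(x, y)\<close> the variables \<open>x\<close> and \<open>y\<close> have the numbers 0 and 1.\<close>

definition sat1 :: "'a pair_pre_digraph \<Rightarrow> (nat \<Rightarrow> 'a set) \<Rightarrow> fo \<Rightarrow> 'a \<Rightarrow> bool" where
  "sat1 G M \<nu> u \<longleftrightarrow> sat G M (\<lambda>_. u) \<nu>"

definition sat2 :: "'a pair_pre_digraph \<Rightarrow> (nat \<Rightarrow> 'a set) \<Rightarrow> fo \<Rightarrow> 'a \<Rightarrow> 'a \<Rightarrow> bool" where
  "sat2 G M \<eta> u v \<longleftrightarrow> sat G M ((\<lambda>_. u)(1 := v)) \<eta>"

definition simple_interpretation :: "nat set \<Rightarrow> fo \<Rightarrow> fo \<Rightarrow> bool" where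
  "simple_interpretation \<Sigma> \<nu> \<eta> \<longleftrightarrow>
     free_vars \<nu> \<subseteq> {0} \<and> free_vars \<eta> \<subseteq> {0, 1} \<and> symbols \<nu> \<subseteq> \<Sigma> \<and> symbols \<eta> \<subseteq> \<Sigma> \<and>
     (\<forall>(G :: ngraph) M. pair_graph G \<and> expansion \<Sigma> G M \<longrightarrow>
        (\<forall>u\<in>pverts G. \<not> sat2 G M \<eta> u u) \<and>
        (\<forall>u\<in>pverts G. \<forall>v\<in>pverts G. sat2 G M \<eta> u v \<longrightarrow> sat2 G M \<eta> v u))"

definition interpret_graph ::
  "fo \<Rightarrow> fo \<Rightarrow> 'a pair_pre_digraph \<Rightarrow> (nat \<Rightarrow> 'a set) \<Rightarrow> 'a pair_pre_digraph" where
  "interpret_graph \<nu> \<eta> G M =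
     (let V = {v \<in> pverts G. sat1 G M \<nu> v}
      in \<lparr> pverts = V, parcs = {(u, v). u \<in> V \<and> v \<in> V \<and> sat2 G M \<eta> u v} \<rparr>)"

definition copy_graph :: "nat \<Rightarrow> 'a pair_pre_digraph \<Rightarrow> ('a \<times> nat) pair_pre_digraph" where
  "copy_graph k G =
     \<lparr> pverts = pverts G \<times> {..<k},
       parcs = {((u, i), (v, j)). u \<in> pverts G \<and> v \<in> pverts G \<and> i < k \<and> j < k \<and>
                  (i = j \<and> (u, v) \<in> parcs G \<or> u = v \<and> i \<noteq> j)} \<rparr>"

text \<open>A transduction is a finite list of elementary operations, applied from left to right.\<close>

datatype operation = Copy nat | NonCopying "nat set" fo fo

primrec operation_ok :: "operation \<Rightarrow> bool" where
  "operation_ok (Copy k) \<longleftrightarrow> k \<ge> 1"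
| "operation_ok (NonCopying \<Sigma> \<nu> \<eta>) \<longleftrightarrow> finite \<Sigma> \<and> simple_interpretation \<Sigma> \<nu> \<eta>"

definition transduction :: "operation list \<Rightarrow> bool" where
  "transduction T \<longleftrightarrow> (\<forall>t\<in>set T. operation_ok t)"

text \<open>The outputs are taken up to isomorphism, so that copying stays within one vertex type.\<close>

primrec op_produces :: "operation \<Rightarrow> ngraph \<Rightarrow> ngraph \<Rightarrow> bool" where
  "op_produces (Copy k) G H \<longleftrightarrow> graph_iso (copy_graph k G) H"
| "op_produces (NonCopying \<Sigma> \<nu> \<eta>) G H \<longleftrightarrow>
     (\<exists>M. expansion \<Sigma> G M \<and> graph_iso (interpret_graph \<nu> \<eta> G M) H)"

primrec produces :: "operation list \<Rightarrow> ngraph \<Rightarrow> ngraph \<Rightarrow> bool" where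
  "produces [] G H \<longleftrightarrow> graph_iso G H"
| "produces (t # T) G H \<longleftrightarrow> (\<exists>K. op_produces t G K \<and> produces T K H)"

definition fo_transducible :: "ngraph set \<Rightarrow> ngraph set \<Rightarrow> bool" (infix \<open>\<sqsubseteq>\<^sub>F\<^sub>O\<close> 50) where
  "C \<sqsubseteq>\<^sub>F\<^sub>O D \<longleftrightarrow> (\<exists>T. transduction T \<and> (\<forall>G\<in>C. \<exists>H\<in>D. produces T H G))"


section \<open>Perturbations\<close>

definition complement_in :: "'a set \<Rightarrow> 'a pair_pre_digraph \<Rightarrow> 'a pair_pre_digraph" where
  "complement_in S G =
     G \<lparr> parcs := {(u, v). u \<in> pverts G \<and> v \<in> pverts G \<and> u \<noteq> v \<and>
                     ((u, v) \<in> parcs G \<longleftrightarrow> \<not> (u \<in> S \<and> v \<in> S))} \<rparr>"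

text \<open>
  Note that \<open>perturbation_of C D\<close> does not require every graph of \<open>D\<close> to be used: if \<open>D\<close> is enlarged,
  \<open>C\<close> remains a perturbation of it.  Complementing a vertex subset is an involution, so
  \<open>perturbation_of D C\<close> says that each graph of \<open>D\<close> is turned into some graph of \<open>C\<close> by a bounded
  number of subset complementations; that \<open>C\<close> is obtained by perturbing the whole of \<open>D\<close> is
  expressed by the conjunction of both.
\<close>

definition perturbation_of :: "ngraph set \<Rightarrow> ngraph set \<Rightarrow> bool" where
  "perturbation_of C D \<longleftrightarrow>
     (\<exists>k. \<forall>G\<in>C. \<exists>H\<in>D. \<exists>Ss. length Ss \<le> k \<and> (\<forall>S\<in>set Ss. S \<subseteq> pverts H) \<and>
        graph_iso (fold complement_in Ss H) G)"


section \<open>Paths, bandwidth and components\<close>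

definition path_graph_of :: "'a list \<Rightarrow> 'a pair_pre_digraph" where
  "path_graph_of vs =
     \<lparr> pverts = set vs,
       parcs = {(vs ! i, vs ! j) | i j. i < length vs \<and> j < length vs \<and> (j = Suc i \<or> i = Suc j)} \<rparr>"

definition path_graphs :: "ngraph set" where
  "path_graphs = {path_graph_of vs | vs. vs \<noteq> [] \<and> distinct vs}"

definition graph_power :: "'a pair_pre_digraph \<Rightarrow> nat \<Rightarrow> 'a pair_pre_digraph" where
  "graph_power G l =
     \<lparr> pverts = pverts G,
       parcs = {(u, v). u \<noteq> v \<and> (\<exists>p. pre_digraph.awalk (with_proj G) u p v \<and> length p \<le> l)} \<rparr>"

text \<open>
  The path \<open>P\<close> ranges over all paths on natural numbers, in any vertex order, so containment as a
  literal subgraph is the same as containment up to isomorphism.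
\<close>

definition bandwidth :: "ngraph \<Rightarrow> nat" where
  "bandwidth G =
     (LEAST l. \<exists>P\<in>path_graphs. subgraph (with_proj G) (with_proj (graph_power P l)))"

definition bounded_bandwidth :: "ngraph set \<Rightarrow> bool" where
  "bounded_bandwidth D \<longleftrightarrow> (\<exists>b. \<forall>G\<in>D. bandwidth G \<le> b)"

text \<open>The connected components of a graph are the strong components of its symmetric digraph.\<close>

definition arbitrarily_large_components :: "ngraph set \<Rightarrow> bool" where
  "arbitrarily_large_components D \<longleftrightarrow>
     (\<forall>n. \<exists>G\<in>D. \<exists>S\<in>pre_digraph.sccs_verts (with_proj G). n \<le> card S)"

end

theory Submission
  imports Defs
begin

text \<open>
  A \<^emph>\<open>layout\<close> of a graph places its vertices injectively on the integers and colours them with boundedly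
  many colours such that the adjacency of two vertices at distance more than \<open>b\<close> depends on their
  colours only.  Graphs with such layouts are exactly the bounded perturbations of graphs of bounded
  bandwidth: complementing inside colour classes and their unions removes all long edges.

  Layouts survive transductions.  A layout turns an expanded graph into a labelled word, and a
  first-order formula cannot distinguish two tuples whose windows of radius \<open>b \<cdot> 3\<^sup>q\<close> agree, where \<open>q\<close> is
  the quantifier rank (Gaifman locality, with the counting argument of Hella, Libkin and Nurmonen).
  So two distant vertices are adjacent in the interpreted graph depending on their windows, which
  serve as new colours.  This yields the perturbed class \<open>D\<close>.  If the components of \<open>D\<close> were bounded,
  they could be placed in blocks so far apart that the blocks stay separated after the transduction;
  but a long path has no such layout, since its maximum degree is 2.

  Conversely, a large component of a graph of bounded bandwidth contains a long induced path, and a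
  subgraph of a power of a path is obtained from the path by squaring it repeatedly and then deleting
  edges, which are identified by the positions of their ends modulo \<open>2 \<cdot> l + 1\<close>.
\<close>


section \<open>Isomorphisms and compositions of transductions\<close>


text \<open>Bounded bandwidth alone is not stable under transductions, since a single formula can
  create edges between distant vertices. Layouts are the stable weakening: short edges are
  arbitrary, long ones are a matter of colours. Positions may leave gaps, and the argument on
  bounded components rests on this. The new distance bound, the new number of colours and the
  refinement factor depend only on the transduction and the old bounds, not on the layout. So the
  gaps between components can be chosen afterwards, wider than any distance that the transduction
  treats as short; edges between blocks are then governed by colours alone. The large components of
  \<open>D\<close> are not read off from \<open>C\<close>. They follow by transitivity: paths are
  transduced from \<open>C\<close>, and \<open>C\<close> is transduced from \<open>D\<close>,
  because complementing inside a marked set is first-order definable.\<close>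

definition iso_map :: "('a \<Rightarrow> 'b) \<Rightarrow> 'a pair_pre_digraph \<Rightarrow> 'b pair_pre_digraph \<Rightarrow> bool" where
  "iso_map f G H \<longleftrightarrow> pair_wf_digraph G \<and> pair_wf_digraph H \<and> bij_betw f (pverts G) (pverts H) \<and>
     (\<forall>u\<in>pverts G. \<forall>v\<in>pverts G. (f u, f v) \<in> parcs H \<longleftrightarrow> (u, v) \<in> parcs G)"

lemma pair_wf_digraph_iff:
  "pair_wf_digraph G \<longleftrightarrow> (\<forall>u v. (u, v) \<in> parcs G \<longrightarrow> u \<in> pverts G \<and> v \<in> pverts G)"
  by (auto simp: pair_wf_digraph_def)

lemma pair_graph_iff:
  "pair_graph G \<longleftrightarrow> finite (pverts G) \<and>
     (\<forall>u v. (u, v) \<in> parcs G \<longrightarrow> u \<in> pverts G \<and> v \<in> pverts G \<and> u \<noteq> v \<and> (v, u) \<in> parcs G)"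
proof
  assume "pair_graph G"
  then interpret pair_graph G .
  show "finite (pverts G) \<and>
     (\<forall>u v. (u, v) \<in> parcs G \<longrightarrow> u \<in> pverts G \<and> v \<in> pverts G \<and> u \<noteq> v \<and> (v, u) \<in> parcs G)"
    using pair_finite_verts wellformed' no_loops' arcs_symmetric by blast
next
  assume *: "finite (pverts G) \<and>
     (\<forall>u v. (u, v) \<in> parcs G \<longrightarrow> u \<in> pverts G \<and> v \<in> pverts G \<and> u \<noteq> v \<and> (v, u) \<in> parcs G)"
  then have "parcs G \<subseteq> pverts G \<times> pverts G" by auto
  then have "finite (parcs G)" using * by (meson finite_SigmaI finite_subset)
  then show "pair_graph G"
    using * by unfold_locales (auto simp: symmetric_def sym_def)
qed

text \<open>A library isomorphism also carries an arc map and new projections. For pair graphs the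
  projections are \<open>fst\<close> and \<open>snd\<close> on both sides, which forces the arc map
  to be the action of the vertex map on pairs; so a vertex bijection carries all the
  information.\<close>

lemma graph_iso_iff: "graph_iso G H \<longleftrightarrow> (\<exists>f. iso_map f G H)"
proof
  assume "graph_iso G H"
  then obtain h where h: "pre_digraph.digraph_isomorphism (with_proj G) h" "with_proj H = app_iso h (with_proj G)"
    by (auto simp: digraph_iso_def)
  let ?f = "iso_verts h"
  have wf: "pair_wf_digraph G" and inj: "inj_on ?f (pverts G)"
    and ts: "\<And>e. e \<in> parcs G \<Longrightarrow> ?f (fst e) = iso_tail h (iso_arcs h e) \<and> ?f (snd e) = iso_head h (iso_arcs h e)"
    using h(1) by (auto simp: pre_digraph.digraph_isomorphism_def wf_digraph_wp_iff)
  have verts: "pverts H = ?f ` pverts G" and arcs: "parcs H = iso_arcs h ` parcs G"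
    and "iso_tail h = fst" "iso_head h = snd"
    using arg_cong[OF h(2), of verts] arg_cong[OF h(2), of arcs] arg_cong[OF h(2), of tail]
      arg_cong[OF h(2), of head] by auto
  then have "iso_arcs h (u, v) = (?f u, ?f v)" if "(u, v) \<in> parcs G" for u v
    using ts[OF that] by (simp add: prod_eq_iff)
  then have parcs: "parcs H = (\<lambda>(u, v). (?f u, ?f v)) ` parcs G"
    unfolding arcs by (intro image_cong) auto
  have "iso_map ?f G H"
    unfolding iso_map_def
  proof (intro conjI ballI)
    show "pair_wf_digraph G" by fact
    show "pair_wf_digraph H"
      using wf parcs verts by (auto simp: pair_wf_digraph_iff)
    show "bij_betw ?f (pverts G) (pverts H)"
      using inj verts by (simp add: bij_betw_def)
    show "(?f u, ?f v) \<in> parcs H \<longleftrightarrow> (u, v) \<in> parcs G" if uv: "u \<in> pverts G" "v \<in> pverts G" for u v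
    proof
      assume "(?f u, ?f v) \<in> parcs H"
      then obtain u' v' where e: "(u', v') \<in> parcs G" "?f u' = ?f u" "?f v' = ?f v"
        unfolding parcs by auto
      then have "u' \<in> pverts G" "v' \<in> pverts G" using wf by (auto simp: pair_wf_digraph_iff)
      then have "u' = u" "v' = v" using e uv inj by (auto dest: inj_onD)
      then show "(u, v) \<in> parcs G" using e by simp
    qed (auto simp: parcs)
  qed
  then show "\<exists>f. iso_map f G H" by blast
next
  assume "\<exists>f. iso_map f G H"
  then obtain f where f: "iso_map f G H" by blast
  define h where "h = \<lparr>iso_verts = f, iso_arcs = (\<lambda>(u, v). (f u, f v)), iso_head = snd, iso_tail = fst\<rparr>"
  have wf: "pair_wf_digraph G" "pair_wf_digraph H" and inj: "inj_on f (pverts G)"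
    and verts: "pverts H = f ` pverts G"
    and ad: "\<And>u v. u \<in> pverts G \<Longrightarrow> v \<in> pverts G \<Longrightarrow> (f u, f v) \<in> parcs H \<longleftrightarrow> (u, v) \<in> parcs G"
    using f by (auto simp: iso_map_def bij_betw_def)
  have "parcs H = (\<lambda>(u, v). (f u, f v)) ` parcs G"
  proof (intro set_eqI iffI)
    fix e assume e: "e \<in> parcs H"
    obtain x y where xy: "e = (x, y)" by fastforce
    then obtain u v where "u \<in> pverts G" "v \<in> pverts G" "x = f u" "y = f v"
      using wf(2) e verts unfolding pair_wf_digraph_iff by blast
    then show "e \<in> (\<lambda>(u, v). (f u, f v)) ` parcs G" using ad e xy by force
  qed (use ad wf(1) in \<open>auto simp: pair_wf_digraph_iff\<close>)
  then have "with_proj H = app_iso h (with_proj G)"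
    using verts by (simp add: with_proj_def app_iso_def h_def)
  moreover have "pre_digraph.digraph_isomorphism (with_proj G) h"
    unfolding pre_digraph.digraph_isomorphism_def
    using wf(1) inj by (auto simp: wf_digraph_wp_iff h_def inj_on_def pair_wf_digraph_iff)
  ultimately show "graph_iso G H" unfolding digraph_iso_def by blast
qed

lemma graph_iso_refl: "pair_wf_digraph G \<Longrightarrow> graph_iso G G"
  unfolding graph_iso_iff by (intro exI[of _ "\<lambda>x. x"]) (auto simp: iso_map_def bij_betw_def)

lemma graph_iso_pair_graph:
  assumes "graph_iso G H" "pair_graph G" shows "pair_graph H"
proof -
  obtain f where f: "iso_map f G H" using assms(1) by (auto simp: graph_iso_iff)
  then have "finite (pverts H)"
    using assms(2) by (auto simp: iso_map_def pair_graph_iff dest: bij_betw_finite)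
  moreover have "x \<in> pverts H \<and> y \<in> pverts H \<and> x \<noteq> y \<and> (y, x) \<in> parcs H" if xy: "(x, y) \<in> parcs H" for x y
  proof -
    have V: "x \<in> pverts H" "y \<in> pverts H"
      using f that by (auto simp: iso_map_def pair_wf_digraph_iff)
    moreover have "pverts H = f ` pverts G" using f by (simp add: iso_map_def bij_betw_def)
    ultimately obtain u v where "u \<in> pverts G" "v \<in> pverts G" "x = f u" "y = f v"
      by blast
    then show ?thesis
      using V xy f assms(2) by (auto simp: iso_map_def pair_graph_iff dest: bij_betw_imp_inj_on inj_onD)
  qed
  ultimately show ?thesis by (simp add: pair_graph_iff)
qed

lemma sat_iso_map:
  assumes iso: "iso_map f G H"
    and M: "\<And>s v. s \<in> symbols \<phi> \<Longrightarrow> v \<in> pverts G \<Longrightarrow> v \<in> M s \<longleftrightarrow> f v \<in> N s"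
    and a: "\<And>x. x \<in> free_vars \<phi> \<Longrightarrow> a x \<in> pverts G \<and> a' x = f (a x)"
  shows "sat H N a' \<phi> \<longleftrightarrow> sat G M a \<phi>"
  using M a
proof (induction \<phi> arbitrary: a a')
  case (Eq x y)
  then show ?case
    using iso by (auto simp: iso_map_def bij_betw_def dest: inj_onD)
next
  case (Adj x y)
  then show ?case
    using iso by (auto simp: iso_map_def)
next
  case (Conj \<phi> \<psi>)
  have "sat H N a' \<phi> \<longleftrightarrow> sat G M a \<phi>" by (rule Conj.IH(1)) (use Conj.prems in auto)
  moreover have "sat H N a' \<psi> \<longleftrightarrow> sat G M a \<psi>" by (rule Conj.IH(2)) (use Conj.prems in auto)
  ultimately show ?case by simp
next
  case (Exists x \<phi>)
  have "sat H N (a'(x := f v)) \<phi> \<longleftrightarrow> sat G M (a(x := v)) \<phi>" if "v \<in> pverts G" for v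
    by (rule Exists.IH) (use Exists.prems that in auto)
  moreover have "pverts H = f ` pverts G"
    using iso by (auto simp: iso_map_def bij_betw_def)
  ultimately show ?case by simp
qed auto

section \<open>Transductions respect isomorphism and compose\<close>

lemma interpret_graph_simps [simp]:
  "pverts (interpret_graph \<nu> \<eta> G M) = {v \<in> pverts G. sat1 G M \<nu> v}"
  "parcs (interpret_graph \<nu> \<eta> G M) = {(u, v). u \<in> pverts G \<and> sat1 G M \<nu> u \<and> v \<in> pverts G \<and>
     sat1 G M \<nu> v \<and> sat2 G M \<eta> u v}"
  by (auto simp: interpret_graph_def)

lemma pair_wf_digraph_interpret_graph: "pair_wf_digraph (interpret_graph \<nu> \<eta> G M)"
  by (auto simp: pair_wf_digraph_iff)

lemma copy_graph_simps [simp]: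
  "pverts (copy_graph k G) = pverts G \<times> {..<k}"
  "parcs (copy_graph k G) = {((u, i), (v, j)). u \<in> pverts G \<and> v \<in> pverts G \<and> i < k \<and> j < k \<and>
                  (i = j \<and> (u, v) \<in> parcs G \<or> u = v \<and> i \<noteq> j)}"
  by (auto simp: copy_graph_def)

lemma interpret_graph_iso:
  assumes iso: "iso_map f G H" and "free_vars \<nu> \<subseteq> {0}" "free_vars \<eta> \<subseteq> {0, 1}"
    and M: "\<And>s v. v \<in> pverts G \<Longrightarrow> v \<in> M s \<longleftrightarrow> f v \<in> N s"
  shows "iso_map f (interpret_graph \<nu> \<eta> G M) (interpret_graph \<nu> \<eta> H N)"
proof -
  have V: "f ` pverts G = pverts H" and inj: "inj_on f (pverts G)"
    using iso by (auto simp: iso_map_def bij_betw_def)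
  have s1: "sat1 H N \<nu> (f u) \<longleftrightarrow> sat1 G M \<nu> u" if "u \<in> pverts G" for u
    unfolding sat1_def using M that by (intro sat_iso_map[OF iso]) auto
  have s2: "sat2 H N \<eta> (f u) (f v) \<longleftrightarrow> sat2 G M \<eta> u v" if "u \<in> pverts G" "v \<in> pverts G" for u v
    unfolding sat2_def using M that by (intro sat_iso_map[OF iso]) auto
  have "{v \<in> pverts H. sat1 H N \<nu> v} = f ` {v \<in> pverts G. sat1 G M \<nu> v}"
    unfolding V[symmetric] using s1 by auto
  moreover have "inj_on f {v \<in> pverts G. sat1 G M \<nu> v}" using inj by (rule inj_on_subset) auto
  moreover have "f u \<in> pverts H" if "u \<in> pverts G" for u using V that by auto
  ultimately show ?thesis
    using s1 s2 by (simp add: iso_map_def pair_wf_digraph_interpret_graph bij_betw_def)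
qed

text \<open>Intermediate results of a transduction are fixed only up to isomorphism, so each
  operation must tolerate an isomorphic input; this is what lets two transductions be
  concatenated.\<close>

lemma op_produces_iso:
  assumes "graph_iso G H" "op_produces t H K" "operation_ok t"
  shows "op_produces t G K"
proof -
  obtain f where f: "iso_map f G H" using assms(1) by (auto simp: graph_iso_iff)
  show ?thesis
  proof (cases t)
    case (Copy k)
    have "iso_map (map_prod f id) (copy_graph k G) (copy_graph k H)"
      unfolding iso_map_def
    proof (intro conjI ballI)
      show "bij_betw (map_prod f id) (pverts (copy_graph k G)) (pverts (copy_graph k H))"
        using f by (simp add: iso_map_def bij_betw_map_prod)
      show "(map_prod f id p, map_prod f id q) \<in> parcs (copy_graph k H) \<longleftrightarrow> (p, q) \<in> parcs (copy_graph k G)"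
        if "p \<in> pverts (copy_graph k G)" "q \<in> pverts (copy_graph k G)" for p q
      proof -
        obtain u i v j where "p = (u, i)" "q = (v, j)" by fastforce
        moreover from this have "u \<in> pverts G" "v \<in> pverts G" "i < k" "j < k" using that by auto
        moreover from this have "f u \<in> pverts H" "f v \<in> pverts H" "f u = f v \<longleftrightarrow> u = v"
          "(f u, f v) \<in> parcs H \<longleftrightarrow> (u, v) \<in> parcs G"
          using f by (auto simp: iso_map_def bij_betw_def dest: inj_onD)
        ultimately show ?thesis by simp
      qed
    qed (auto simp: pair_wf_digraph_iff)
    then have "graph_iso (copy_graph k G) (copy_graph k H)" by (auto simp: graph_iso_iff)
    then show ?thesis using assms(2) Copy by (auto intro: digraph_iso_trans)
  next
    case (NonCopying \<Sigma> \<nu> \<eta>)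
    then obtain N where N: "graph_iso (interpret_graph \<nu> \<eta> H N) K"
      using assms(2) by auto
    \<comment> \<open>The unary predicates are pulled back along \<open>f\<close>.\<close>
    define M where "M s = {v \<in> pverts G. f v \<in> N s}" for s
    have "iso_map f (interpret_graph \<nu> \<eta> G M) (interpret_graph \<nu> \<eta> H N)"
      by (rule interpret_graph_iso[OF f])
        (use assms(3) NonCopying in \<open>auto simp: simple_interpretation_def M_def\<close>)
    then have "graph_iso (interpret_graph \<nu> \<eta> G M) K"
      using N by (meson graph_iso_iff digraph_iso_trans)
    moreover have "expansion \<Sigma> G M" by (auto simp: expansion_def M_def)
    ultimately show ?thesis using NonCopying by auto
  qed
qed

lemma produces_iso:
  assumes "graph_iso G H" "produces T H K" "transduction T"
  shows "produces T G K"
proof (cases T)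
  case Nil
  then show ?thesis using assms by (auto intro: digraph_iso_trans)
next
  case (Cons t T')
  then show ?thesis using assms op_produces_iso by (fastforce simp: transduction_def)
qed

lemma produces_append:
  assumes "produces S G K" "produces T K H" "transduction T"
  shows "produces (S @ T) G H"
  using assms(1)
proof (induction S arbitrary: G)
  case Nil
  then show ?case using produces_iso[OF _ assms(2,3)] by simp
next
  case (Cons t S)
  then show ?case by auto
qed

lemma transduction_append: "transduction S \<Longrightarrow> transduction T \<Longrightarrow> transduction (S @ T)"
  by (auto simp: transduction_def)

lemma fo_transducible_trans:
  assumes "A \<sqsubseteq>\<^sub>F\<^sub>O B" "B \<sqsubseteq>\<^sub>F\<^sub>O C"
  shows "A \<sqsubseteq>\<^sub>F\<^sub>O C"
proof -
  obtain S T where "transduction S" "\<forall>G\<in>A. \<exists>H\<in>B. produces S H G"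
    "transduction T" "\<forall>G\<in>B. \<exists>H\<in>C. produces T H G"
    using assms unfolding fo_transducible_def by blast
  then have "transduction (T @ S)" "\<forall>G\<in>A. \<exists>H\<in>C. produces (T @ S) H G"
    by (auto intro: transduction_append) (meson produces_append)
  then show ?thesis unfolding fo_transducible_def by blast
qed

lemma interpret_graph_pair_graph:
  assumes "pair_graph (G :: ngraph)" "simple_interpretation \<Sigma> \<nu> \<eta>" "expansion \<Sigma> G M"
  shows "pair_graph (interpret_graph \<nu> \<eta> G M)"
  using assms by (auto simp: pair_graph_iff simple_interpretation_def)

lemma op_produces_pair_graph:
  assumes "op_produces t G H" "pair_graph G" "operation_ok t"
  shows "pair_graph H"
proof (cases t)
  case (Copy k)
  moreover have "pair_graph (copy_graph k G)" using assms(2) by (auto simp: pair_graph_iff)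
  ultimately show ?thesis using assms(1) graph_iso_pair_graph by auto
next
  case (NonCopying \<Sigma> \<nu> \<eta>)
  then show ?thesis
    using assms graph_iso_pair_graph interpret_graph_pair_graph by fastforce
qed


section \<open>Locality of first-order formulas on labelled layouts\<close>


text \<open>Atoms look no farther than \<open>b\<close>. Each quantifier triples the radius, so that
  the window of an element chosen near an old one fits into the window of the old one.\<close>

primrec fo_radius :: "int \<Rightarrow> fo \<Rightarrow> int" where
  "fo_radius b (Eq x y) = b"
| "fo_radius b (Adj x y) = b"
| "fo_radius b (Pred s x) = b"
| "fo_radius b (Neg \<phi>) = fo_radius b \<phi>"
| "fo_radius b (Conj \<phi> \<psi>) = max (fo_radius b \<phi>) (fo_radius b \<psi>)"
| "fo_radius b (Exists x \<phi>) = 3 * fo_radius b \<phi>"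

lemma fo_radius_ge: "0 \<le> b \<Longrightarrow> b \<le> fo_radius b \<phi>"
  by (induction \<phi>) auto

text \<open>An expanded graph read as a word over the integers. A label tells whether a vertex sits
  at the position and which symbols hold there; two labels determine adjacency together with the
  offset, or without it when the vertices are more than \<open>b\<close> apart.\<close>

locale labelled_layout =
  fixes G :: "'a pair_pre_digraph" and M :: "nat \<Rightarrow> 'a set" and S :: "nat set"
    and f :: "'a \<Rightarrow> int" and lab :: "int \<Rightarrow> 'l" and b :: int
  assumes finite_verts: "finite (pverts G)"
    and inj: "inj_on f (pverts G)"
    and b_nonneg: "0 \<le> b"
    and occupied: "v \<in> pverts G \<Longrightarrow> lab (f v) = lab q \<Longrightarrow> q \<in> f ` pverts G"
    and preds: "s \<in> S \<Longrightarrow> u \<in> pverts G \<Longrightarrow> v \<in> pverts G \<Longrightarrow> lab (f u) = lab (f v) \<Longrightarrow> u \<in> M s \<longleftrightarrow> v \<in> M s"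
    and adj: "\<lbrakk>u \<in> pverts G; v \<in> pverts G; u' \<in> pverts G; v' \<in> pverts G;
        lab (f u) = lab (f u'); lab (f v) = lab (f v');
        f u - f v = f u' - f v' \<or> b < \<bar>f u - f v\<bar> \<and> b < \<bar>f u' - f v'\<bar>\<rbrakk>
      \<Longrightarrow> (u, v) \<in> parcs G \<longleftrightarrow> (u', v') \<in> parcs G"
begin

text \<open>The invariant of the Ehrenfeucht-Fraisse game. By the disjunction in the second clause,
  a pair has either the same offset on both sides or distance more than \<open>r\<close> on both
  sides.\<close>

definition similar :: "int \<Rightarrow> nat set \<Rightarrow> (nat \<Rightarrow> int) \<Rightarrow> (nat \<Rightarrow> int) \<Rightarrow> bool" where
  "similar r X p q \<longleftrightarrow>
     (\<forall>i\<in>X. \<forall>k. \<bar>k\<bar> \<le> r \<longrightarrow> lab (p i + k) = lab (q i + k)) \<and>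
     (\<forall>i\<in>X. \<forall>j\<in>X. \<bar>p i - p j\<bar> \<le> r \<or> \<bar>q i - q j\<bar> \<le> r \<longrightarrow> p i - p j = q i - q j)"

lemma similar_label: "similar r X p q \<Longrightarrow> i \<in> X \<Longrightarrow> 0 \<le> r \<Longrightarrow> lab (p i) = lab (q i)"
  unfolding similar_def by (metis abs_zero add_0_right)

lemma similar_diff:
  "\<lbrakk>similar r X p q; i \<in> X; j \<in> X; \<bar>p i - p j\<bar> \<le> r \<or> \<bar>q i - q j\<bar> \<le> r\<rbrakk> \<Longrightarrow> p i - p j = q i - q j"
  unfolding similar_def by blast

lemma similar_sym: "similar r X p q \<Longrightarrow> similar r X q p"
  unfolding similar_def by metis

lemma similar_mono: "similar r X p q \<Longrightarrow> r' \<le> r \<Longrightarrow> Y \<subseteq> X \<Longrightarrow> similar r' Y p q"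
  unfolding similar_def by (meson order_trans subsetD)

lemma similar_insert:
  assumes "similar r X p q" and "x \<notin> X"
    and "\<And>k. \<bar>k\<bar> \<le> r \<Longrightarrow> lab (c + k) = lab (d + k)"
    and "\<And>i. i \<in> X \<Longrightarrow> \<bar>c - p i\<bar> \<le> r \<or> \<bar>d - q i\<bar> \<le> r \<Longrightarrow> c - p i = d - q i"
  shows "similar r (insert x X) (p(x := c)) (q(x := d))"
proof -
  have "p i - c = q i - d" if "i \<in> X" "\<bar>p i - c\<bar> \<le> r \<or> \<bar>q i - d\<bar> \<le> r" for i
    using assms(4)[OF that(1)] that(2) by linarith
  note pd = this
  show ?thesis
    unfolding similar_def
  proof (intro conjI ballI allI impI)
    show "lab ((p(x := c)) i + k) = lab ((q(x := d)) i + k)" if "i \<in> insert x X" "\<bar>k\<bar> \<le> r" for i k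
      using that assms(1,3) by (cases "i = x") (auto simp: similar_def)
    show "(p(x := c)) i - (p(x := c)) j = (q(x := d)) i - (q(x := d)) j"
      if ij: "i \<in> insert x X" "j \<in> insert x X"
        and le: "\<bar>(p(x := c)) i - (p(x := c)) j\<bar> \<le> r \<or> \<bar>(q(x := d)) i - (q(x := d)) j\<bar> \<le> r" for i j
    proof (cases "i = x"; cases "j = x")
      assume "i = x" "j \<noteq> x"
      then have "j \<in> X" "\<bar>c - p j\<bar> \<le> r \<or> \<bar>d - q j\<bar> \<le> r" using ij le by auto
      then have "c - p j = d - q j" by (rule assms(4))
      then show ?thesis using \<open>i = x\<close> \<open>j \<noteq> x\<close> by simp
    next
      assume "i \<noteq> x" "j = x"
      then have "i \<in> X" "\<bar>p i - c\<bar> \<le> r \<or> \<bar>q i - d\<bar> \<le> r" using ij le by auto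
      then have "p i - c = q i - d" by (rule pd)
      then show ?thesis using \<open>i \<noteq> x\<close> \<open>j = x\<close> by simp
    next
      assume "i \<noteq> x" "j \<noteq> x"
      then have "i \<in> X" "j \<in> X" "\<bar>p i - p j\<bar> \<le> r \<or> \<bar>q i - q j\<bar> \<le> r" using ij le by auto
      then have "p i - p j = q i - q j" using assms(1) unfolding similar_def by blast
      then show ?thesis using \<open>i \<noteq> x\<close> \<open>j \<noteq> x\<close> by simp
    qed auto
  qed
qed

text \<open>
  If \<open>c\<close> is far from all \<open>p i\<close>, then the translations \<open>p i + k \<mapsto> q i + k\<close> show that the windows of the
  shape of the one around \<open>c\<close> occur equally often near \<open>p\<close> and near \<open>q\<close>; the one at \<open>c\<close> is not near
  \<open>p\<close>, so there is also one that is not near \<open>q\<close>.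
\<close>

lemma similar_extend_far:
  assumes sim: "similar (3 * r) X p q" and r: "0 \<le> r"
    and c: "c \<in> f ` pverts G" and far: "\<And>i. i \<in> X \<Longrightarrow> r < \<bar>c - p i\<bar>"
  obtains d where "\<And>k. \<bar>k\<bar> \<le> r \<Longrightarrow> lab (c + k) = lab (d + k)" "\<And>i. i \<in> X \<Longrightarrow> r < \<bar>d - q i\<bar>"
proof -
  define T where "T = {z. \<forall>k. \<bar>k\<bar> \<le> r \<longrightarrow> lab (c + k) = lab (z + k)}"
  define near where "near y = {z \<in> T. \<exists>i\<in>X. \<bar>z - y i\<bar> \<le> r}" for y :: "nat \<Rightarrow> int"
  have "T \<subseteq> f ` pverts G"
  proof
    fix z assume "z \<in> T"
    then have "\<And>k. \<bar>k\<bar> \<le> r \<Longrightarrow> lab (c + k) = lab (z + k)" by (simp add: T_def)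
    from this[of 0] r have "lab c = lab z" by simp
    then show "z \<in> f ` pverts G" using c occupied by blast
  qed
  then have finT: "finite T" using finite_verts finite_subset by blast
  then have fin: "finite (near y)" for y by (simp add: near_def)
  have "c \<in> T" "c \<notin> near p" using far by (auto simp: T_def near_def not_le)
  then have lt: "card (near p) < card T"
    using finT by (intro psubset_card_mono) (auto simp: near_def)
  \<comment> \<open>Each window near \<open>q\<close> gets one anchor, whose translation carries it
    over to \<open>p\<close>.\<close>
  define I where "I z = (SOME i. i \<in> X \<and> \<bar>z - q i\<bar> \<le> r)" for z
  have I: "I z \<in> X \<and> \<bar>z - q (I z)\<bar> \<le> r" if "z \<in> near q" for z
    using that someI_ex[of "\<lambda>i. i \<in> X \<and> \<bar>z - q i\<bar> \<le> r"] by (auto simp: I_def near_def)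
  define t where "t z = p (I z) + (z - q (I z))" for z
  have "inj_on t (near q)"
  proof (rule inj_onI)
    fix z z' assume z: "z \<in> near q" "z' \<in> near q" and eq: "t z = t z'"
    \<comment> \<open>Windows with equal translates have anchors within \<open>2 * r\<close> of each
      other; the second clause of \<open>similar\<close> then makes the two translations the
      same.\<close>
    have "\<bar>p (I z) - p (I z')\<bar> \<le> 3 * r" using I[OF z(1)] I[OF z(2)] eq r unfolding t_def by linarith
    then have "p (I z) - p (I z') = q (I z) - q (I z')"
      using sim I[OF z(1)] I[OF z(2)] unfolding similar_def by blast
    then show "z = z'" using eq unfolding t_def by linarith
  qed
  moreover have "t ` near q \<subseteq> near p"
  proof safe
    fix z assume z: "z \<in> near q"
    have "lab (c + k) = lab (t z + k)" if k: "\<bar>k\<bar> \<le> r" for k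
    proof -
      have "\<bar>z - q (I z) + k\<bar> \<le> 3 * r" using I[OF z] k r by linarith
      then have "lab (p (I z) + (z - q (I z) + k)) = lab (q (I z) + (z - q (I z) + k))"
        using sim I[OF z] unfolding similar_def by blast
      moreover have "lab (c + k) = lab (z + k)" using z k by (auto simp: near_def T_def)
      ultimately show ?thesis by (simp add: t_def algebra_simps)
    qed
    then show "t z \<in> near p"
      using I[OF z] by (auto simp: near_def T_def t_def intro!: bexI[of _ "I z"])
  qed
  ultimately have "card (near q) \<le> card (near p)" using fin card_inj_on_le by blast
  then have "\<not> T \<subseteq> near q" using lt card_mono[OF fin, of T q] by linarith
  then obtain d where "d \<in> T" "d \<notin> near q" by blast
  then show ?thesis using that by (auto simp: near_def T_def not_le)
qed

text \<open>A move close to a marked position is answered by the same offset, any other move by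
  counting. With the threshold \<open>2 * r\<close> the window of \<open>c\<close> stays inside the
  known window of radius \<open>3 * r\<close>. Any other marked position within \<open>r\<close> of
  \<open>c\<close> or of \<open>d\<close> is within \<open>3 * r\<close> of the anchor on that side,
  where offsets are known to agree.\<close>

lemma similar_extend:
  assumes sim: "similar (3 * r) X p q" and r: "0 \<le> r" and x: "x \<notin> X"
    and c: "c \<in> f ` pverts G"
  obtains d where "d \<in> f ` pverts G" "similar r (insert x X) (p(x := c)) (q(x := d))"
proof -
  have sim_r: "similar r X p q" using similar_mono[OF sim] r by auto
  have occ: "d \<in> f ` pverts G" if "\<And>k. \<bar>k\<bar> \<le> r \<Longrightarrow> lab (c + k) = lab (d + k)" for d
    using that[of 0] r c occupied by auto
  show ?thesis
  proof (cases "\<exists>i\<in>X. \<bar>c - p i\<bar> \<le> 2 * r")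
    case True
    then obtain i where i: "i \<in> X" "\<bar>c - p i\<bar> \<le> 2 * r" by blast
    define d where "d = q i + (c - p i)"
    have lab: "lab (c + k) = lab (d + k)" if k: "\<bar>k\<bar> \<le> r" for k
    proof -
      have "\<bar>c - p i + k\<bar> \<le> 3 * r" using i(2) k by linarith
      then have "lab (p i + (c - p i + k)) = lab (q i + (c - p i + k))"
        using sim i(1) unfolding similar_def by blast
      then show ?thesis by (simp add: d_def algebra_simps)
    qed
    moreover have "c - p j = d - q j" if j: "j \<in> X" "\<bar>c - p j\<bar> \<le> r \<or> \<bar>d - q j\<bar> \<le> r" for j
    proof -
      have "\<bar>p i - p j\<bar> \<le> 3 * r \<or> \<bar>q i - q j\<bar> \<le> 3 * r"
        using i(2) j(2) unfolding d_def by linarith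
      then have "p i - p j = q i - q j" using sim i(1) j(1) unfolding similar_def by blast
      then show ?thesis by (simp add: d_def)
    qed
    ultimately show ?thesis using that[of d] occ[of d] similar_insert[OF sim_r x] by blast
  next
    case False
    then have far: "r < \<bar>c - p i\<bar>" if "i \<in> X" for i using that r by fastforce
    obtain d where "\<And>k. \<bar>k\<bar> \<le> r \<Longrightarrow> lab (c + k) = lab (d + k)" "\<And>i. i \<in> X \<Longrightarrow> r < \<bar>d - q i\<bar>"
      using similar_extend_far[OF sim r c far] by blast
    then show ?thesis
      using that[of d] occ[of d] far by (metis not_le similar_insert[OF sim_r x])
  qed
qed

text \<open>The quantifier case plays one move of the game and spends two thirds of the radius. The
  old value of the bound variable is dropped before the move, because the quantifier overwrites it.
  One direction is enough, as similarity is symmetric.\<close>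

lemma similar_sat:
  assumes "symbols \<phi> \<subseteq> S"
    and "\<And>x. x \<in> free_vars \<phi> \<Longrightarrow> a x \<in> pverts G" "\<And>x. x \<in> free_vars \<phi> \<Longrightarrow> a' x \<in> pverts G"
    and "similar (fo_radius b \<phi>) (free_vars \<phi>) (\<lambda>x. f (a x)) (\<lambda>x. f (a' x))"
  shows "sat G M a \<phi> \<longleftrightarrow> sat G M a' \<phi>"
  using assms
proof (induction \<phi> arbitrary: a a')
  case (Eq x y)
  have sim: "similar b {x, y} (\<lambda>x. f (a x)) (\<lambda>x. f (a' x))" using Eq.prems(4) by simp
  have "f (a x) = f (a y) \<longleftrightarrow> f (a' x) = f (a' y)"
  proof (rule ccontr)
    assume ne: "\<not> ?thesis"
    then have "\<bar>f (a x) - f (a y)\<bar> \<le> b \<or> \<bar>f (a' x) - f (a' y)\<bar> \<le> b" using b_nonneg by auto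
    then have "f (a x) - f (a y) = f (a' x) - f (a' y)"
      using similar_diff[OF sim, of x y] by blast
    then show False using ne by linarith
  qed
  then show ?case using Eq.prems(2,3) inj by (simp add: inj_on_eq_iff)
next
  case (Adj x y)
  have sim: "similar b {x, y} (\<lambda>x. f (a x)) (\<lambda>x. f (a' x))" using Adj.prems(4) by simp
  have "lab (f (a x)) = lab (f (a' x))" "lab (f (a y)) = lab (f (a' y))"
    using similar_label[OF sim] b_nonneg by blast+
  moreover have "f (a x) - f (a y) = f (a' x) - f (a' y) \<or>
      b < \<bar>f (a x) - f (a y)\<bar> \<and> b < \<bar>f (a' x) - f (a' y)\<bar>"
    using similar_diff[OF sim, of x y] unfolding not_le[symmetric] by blast
  ultimately show ?case using adj[of "a x" "a y" "a' x" "a' y"] Adj.prems(2,3) by simp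
next
  case (Pred s x)
  have sim: "similar b {x} (\<lambda>x. f (a x)) (\<lambda>x. f (a' x))" using Pred.prems(4) by simp
  have "lab (f (a x)) = lab (f (a' x))"
    using similar_label[OF sim] b_nonneg by blast
  then show ?case using preds[of s "a x" "a' x"] Pred.prems(1-3) by simp
next
  case (Neg \<phi>)
  then show ?case by simp
next
  case (Conj \<phi> \<psi>)
  have "sat G M a \<phi> \<longleftrightarrow> sat G M a' \<phi>"
    by (rule Conj.IH(1)) (use Conj.prems in \<open>auto intro: similar_mono\<close>)
  moreover have "sat G M a \<psi> \<longleftrightarrow> sat G M a' \<psi>"
    by (rule Conj.IH(2)) (use Conj.prems in \<open>auto intro: similar_mono\<close>)
  ultimately show ?case by simp
next
  case (Exists x \<phi>)
  let ?X = "free_vars \<phi> - {x}"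
  have r: "0 \<le> fo_radius b \<phi>" using fo_radius_ge b_nonneg order_trans by blast
  have step: "sat G M a' (Exists x \<phi>)"
    if sat: "sat G M a (Exists x \<phi>)" and a: "\<And>x. x \<in> ?X \<Longrightarrow> a x \<in> pverts G"
      and a': "\<And>x. x \<in> ?X \<Longrightarrow> a' x \<in> pverts G"
      and sim: "similar (3 * fo_radius b \<phi>) ?X (\<lambda>x. f (a x)) (\<lambda>x. f (a' x))" for a a'
  proof -
    obtain v where v: "v \<in> pverts G" "sat G M (a(x := v)) \<phi>" using sat by auto
    obtain d where "d \<in> f ` pverts G"
      and d: "similar (fo_radius b \<phi>) (insert x ?X) ((\<lambda>x. f (a x))(x := f v)) ((\<lambda>x. f (a' x))(x := d))"
      using similar_extend[OF sim r, of x "f v"] v(1) by blast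
    then obtain w where w: "w \<in> pverts G" "d = f w" by blast
    have "similar (fo_radius b \<phi>) (free_vars \<phi>) (\<lambda>y. f ((a(x := v)) y)) (\<lambda>y. f ((a'(x := w)) y))"
    proof -
      have "(\<lambda>y. f ((a(x := v)) y)) = (\<lambda>x. f (a x))(x := f v)"
        "(\<lambda>y. f ((a'(x := w)) y)) = (\<lambda>x. f (a' x))(x := d)" using w(2) by auto
      then show ?thesis using similar_mono[OF d, of "fo_radius b \<phi>" "free_vars \<phi>"] by auto
    qed
    then have "sat G M (a(x := v)) \<phi> \<longleftrightarrow> sat G M (a'(x := w)) \<phi>"
      using Exists.prems(1) a a' v(1) w(1) by (intro Exists.IH) auto
    then show ?thesis using v w by auto
  qed
  show ?case
    using step[of a a'] step[of a' a] Exists.prems similar_sym by auto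
qed

end


section \<open>Transductions preserve layouts\<close>


text \<open>Only \<open>b\<close> and \<open>k\<close> are exposed besides the positions: the
  colouring and the relation vary from graph to graph, while these two bounds can be uniform over a
  class.\<close>

definition layout :: "('a \<Rightarrow> int) \<Rightarrow> int \<Rightarrow> nat \<Rightarrow> 'a pair_pre_digraph \<Rightarrow> bool" where
  "layout f b k G \<longleftrightarrow> 0 \<le> b \<and> inj_on f (pverts G) \<and>
     (\<exists>(col :: 'a \<Rightarrow> nat) R. (\<forall>v\<in>pverts G. col v < k) \<and>
        (\<forall>u\<in>pverts G. \<forall>v\<in>pverts G. b < \<bar>f u - f v\<bar> \<longrightarrow> ((u, v) \<in> parcs G \<longleftrightarrow> R (col u) (col v))))"

text \<open>Colours arise naturally as words or pairs; numbering the finite set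
  \<open>\<Gamma>\<close> turns them into the naturals below \<open>k\<close>.\<close>

lemma layoutI:
  fixes col :: "'a \<Rightarrow> 'c"
  assumes "0 \<le> b" "inj_on f (pverts G)" and fin: "finite \<Gamma>" "card \<Gamma> = k"
    and col: "\<And>v. v \<in> pverts G \<Longrightarrow> col v \<in> \<Gamma>"
    and far: "\<And>u v. u \<in> pverts G \<Longrightarrow> v \<in> pverts G \<Longrightarrow> b < \<bar>f u - f v\<bar> \<Longrightarrow>
      (u, v) \<in> parcs G \<longleftrightarrow> R (col u) (col v)"
  shows "layout f b k G"
proof -
  obtain h where h: "bij_betw h \<Gamma> {..<k}"
    using ex_bij_betw_finite_nat[OF fin(1)] fin(2) by (auto simp: atLeast0LessThan)
  define R' where "R' i j \<longleftrightarrow> R (the_inv_into \<Gamma> h i) (the_inv_into \<Gamma> h j)" for i j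
  have inv: "the_inv_into \<Gamma> h (h (col v)) = col v" if "v \<in> pverts G" for v
    using h col[OF that] by (auto simp: bij_betw_def the_inv_into_f_f)
  have "h (col v) < k" if "v \<in> pverts G" for v
    using bij_betwE[OF h] col[OF that] by auto
  moreover have "(u, v) \<in> parcs G \<longleftrightarrow> R' (h (col u)) (h (col v))"
    if "u \<in> pverts G" "v \<in> pverts G" "b < \<bar>f u - f v\<bar>" for u v
    using far[OF that] by (simp only: R'_def inv[OF that(1)] inv[OF that(2)])
  ultimately show ?thesis
    unfolding layout_def using assms(1,2)
    by (intro conjI exI[of _ "\<lambda>v. h (col v)"] exI[of _ R']) auto
qed

lemma layout_iso:
  assumes "iso_map h G H" "layout f b k G"
  shows "layout (\<lambda>v. f (the_inv_into (pverts G) h v)) b k H"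
proof -
  let ?i = "the_inv_into (pverts G) h"
  have bij: "bij_betw h (pverts G) (pverts H)" using assms(1) by (simp add: iso_map_def)
  then have inj: "inj_on h (pverts G)" and im: "h ` pverts G = pverts H" by (auto simp: bij_betw_def)
  have i: "?i v \<in> pverts G" "h (?i v) = v" if "v \<in> pverts H" for v
    using that im the_inv_into_into[OF inj] f_the_inv_into_f[OF inj] by auto
  obtain col :: "'a \<Rightarrow> nat" and R where *: "0 \<le> b" "inj_on f (pverts G)" "\<And>v. v \<in> pverts G \<Longrightarrow> col v < k"
    "\<And>u v. u \<in> pverts G \<Longrightarrow> v \<in> pverts G \<Longrightarrow> b < \<bar>f u - f v\<bar> \<Longrightarrow>
       (u, v) \<in> parcs G \<longleftrightarrow> R (col u) (col v)"
    using assms(2) unfolding layout_def by blast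
  show ?thesis
  proof (rule layoutI[where col = "\<lambda>v. col (?i v)" and \<Gamma> = "{..<k}" and R = R])
    show "inj_on (\<lambda>v. f (?i v)) (pverts H)"
      by (rule inj_onI) (metis *(2) i inj_onD)
    show "(u, v) \<in> parcs H \<longleftrightarrow> R (col (?i u)) (col (?i v))"
      if "u \<in> pverts H" "v \<in> pverts H" "b < \<bar>f (?i u) - f (?i v)\<bar>" for u v
      using *(4)[OF i(1)[OF that(1)] i(1)[OF that(2)] that(3)] assms(1) i[OF that(1)] i[OF that(2)]
      unfolding iso_map_def by metis
  qed (use * i in auto)
qed

text \<open>
  The label of an occupied position consists of the colour of the vertex, the offsets of its
  neighbours at distance at most \<open>b\<close>, and the symbols that hold at it.
\<close>

definition windows :: "int \<Rightarrow> int \<Rightarrow> nat \<Rightarrow> nat set \<Rightarrow> (int \<Rightarrow> (nat \<times> int set \<times> nat set) option) set" where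
  "windows r b k \<Sigma> = (\<Pi>\<^sub>E i\<in>{-r..r}. insert None (Some ` ({..<k} \<times> Pow {-b..b} \<times> Pow \<Sigma>)))"

lemma finite_windows: "finite \<Sigma> \<Longrightarrow> finite (windows r b k \<Sigma>)"
  unfolding windows_def by (intro finite_PiE) auto

text \<open>The new colour of a vertex is the labelled word in its window of radius
  \<open>fo_radius b \<eta>\<close>. Two pairs with the same colours, both farther apart than this
  radius, are similar tuples, so \<eta> has the same value on them. The possible windows form a
  finite set that depends on \<open>b\<close>, \<open>k\<close>, \<Sigma> and \<eta> only, which
  makes the number of colours uniform.\<close>

lemma layout_interpret_graph:
  assumes lay: "layout f b k G" and fin: "finite (pverts G)" "finite \<Sigma>"
    and sym: "symbols \<eta> \<subseteq> \<Sigma>" and fv: "free_vars \<eta> \<subseteq> {0, 1}"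
  shows "layout f (fo_radius b \<eta>) (card (windows (fo_radius b \<eta>) b k \<Sigma>)) (interpret_graph \<nu> \<eta> G M)"
proof -
  let ?V = "pverts G" and ?r = "fo_radius b \<eta>"
  obtain col :: "'a \<Rightarrow> nat" and R where b: "0 \<le> b" and inj: "inj_on f ?V"
    and col: "\<And>v. v \<in> ?V \<Longrightarrow> col v < k"
    and far: "\<And>u v. u \<in> ?V \<Longrightarrow> v \<in> ?V \<Longrightarrow> b < \<bar>f u - f v\<bar> \<Longrightarrow>
       (u, v) \<in> parcs G \<longleftrightarrow> R (col u) (col v)"
    using lay unfolding layout_def by blast
  have r: "0 \<le> ?r" using fo_radius_ge[OF b] b by (rule order_trans[rotated])
  define nbs where "nbs v = {d \<in> {-b..b}. \<exists>u\<in>?V. f u = f v + d \<and> (v, u) \<in> parcs G}" for v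
  define lab where "lab p = (if p \<in> f ` ?V then let v = the_inv_into ?V f p in
    Some (col v, nbs v, {s \<in> \<Sigma>. v \<in> M s}) else None)" for p
  have lab: "lab (f v) = Some (col v, nbs v, {s \<in> \<Sigma>. v \<in> M s})" if "v \<in> ?V" for v
    using that inj by (simp add: lab_def the_inv_into_f_f)
  have lab_range: "lab p \<in> insert None (Some ` ({..<k} \<times> Pow {-b..b} \<times> Pow \<Sigma>))" for p
  proof (cases "p \<in> f ` ?V")
    case True
    then obtain v where "v \<in> ?V" "p = f v" by blast
    then show ?thesis using col by (auto simp: lab nbs_def)
  qed (simp add: lab_def)
  \<comment> \<open>Since \<open>f\<close> is injective, the offset alone identifies the
    neighbour.\<close>
  have near: "(u, v) \<in> parcs G \<longleftrightarrow> f v - f u \<in> nbs u" if "u \<in> ?V" "v \<in> ?V" "\<bar>f u - f v\<bar> \<le> b" for u v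
  proof -
    have "(\<exists>w\<in>?V. f w = f v \<and> (u, w) \<in> parcs G) \<longleftrightarrow> (u, v) \<in> parcs G"
      using inj that by (auto dest: inj_onD)
    then show ?thesis using that(3) by (auto simp: nbs_def)
  qed
  interpret labelled_layout G M \<Sigma> f lab b
  proof
    show "q \<in> f ` ?V" if "v \<in> ?V" "lab (f v) = lab q" for v q
      using that lab[of v] by (auto simp: lab_def split: if_splits)
    show "u \<in> M s \<longleftrightarrow> v \<in> M s" if "s \<in> \<Sigma>" "u \<in> ?V" "v \<in> ?V" "lab (f u) = lab (f v)" for s u v
      using that lab[of u] lab[of v] by auto
    show "(u, v) \<in> parcs G \<longleftrightarrow> (u', v') \<in> parcs G"
      if V: "u \<in> ?V" "v \<in> ?V" "u' \<in> ?V" "v' \<in> ?V"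
        and eq: "lab (f u) = lab (f u')" "lab (f v) = lab (f v')"
        and diff: "f u - f v = f u' - f v' \<or> b < \<bar>f u - f v\<bar> \<and> b < \<bar>f u' - f v'\<bar>" for u v u' v'
    proof -
      have c: "col u = col u'" "col v = col v'" "nbs u = nbs u'"
        using eq V by (simp_all add: lab)
      show ?thesis
      proof (cases "\<bar>f u - f v\<bar> \<le> b")
        case True
        then have "f u - f v = f u' - f v'" using diff by linarith
        then have "\<bar>f u' - f v'\<bar> \<le> b" "f v - f u = f v' - f u'" using True by linarith+
        then show ?thesis using near[OF V(1,2) True] near[OF V(3,4)] c by simp
      next
        case False
        then have "b < \<bar>f u - f v\<bar>" "b < \<bar>f u' - f v'\<bar>" using diff by linarith+
        then show ?thesis using far V c by simp
      qed
    qed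
  qed (use fin inj b in auto)
  define colour where "colour v = (\<lambda>i\<in>{-?r..?r}. lab (f v + i))" for v
  have sat2: "sat2 G M \<eta> u v \<longleftrightarrow> sat2 G M \<eta> u' v'"
    if V: "u \<in> ?V" "v \<in> ?V" "u' \<in> ?V" "v' \<in> ?V"
      and c: "colour u = colour u'" "colour v = colour v'"
      and d: "?r < \<bar>f u - f v\<bar>" "?r < \<bar>f u' - f v'\<bar>" for u v u' v'
  proof -
    let ?a = "(\<lambda>_. u)(1 := v)" and ?a' = "(\<lambda>_. u')(1 := v')"
    have eq: "lab (f x + i) = lab (f x' + i)" if "colour x = colour x'" "\<bar>i\<bar> \<le> ?r" for x x' i
      using fun_cong[OF that(1), of i] that(2) by (auto simp: colour_def abs_le_iff)
    have "similar ?r {0, 1} (\<lambda>x. f (?a x)) (\<lambda>x. f (?a' x))"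
      unfolding similar_def
    proof (intro conjI ballI allI impI)
      show "lab (f (?a i) + k) = lab (f (?a' i) + k)" if "i \<in> {0, 1}" "\<bar>k\<bar> \<le> ?r" for i k
        using eq[OF c(1) that(2)] eq[OF c(2) that(2)] by simp
      show "f (?a i) - f (?a j) = f (?a' i) - f (?a' j)"
        if "i \<in> {0, 1}" "j \<in> {0, 1}"
          and "\<bar>f (?a i) - f (?a j)\<bar> \<le> ?r \<or> \<bar>f (?a' i) - f (?a' j)\<bar> \<le> ?r" for i j
        using that d by (auto simp: abs_minus_commute split: if_splits)
    qed
    then have "similar ?r (free_vars \<eta>) (\<lambda>x. f (?a x)) (\<lambda>x. f (?a' x))"
      by (rule similar_mono[OF _ order_refl fv])
    then show ?thesis
      unfolding sat2_def using V by (intro similar_sat[OF sym]) auto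
  qed
  \<comment> \<open>The relation is read off from any distant pair realising the two colours; the
    fact \<open>sat2\<close> makes it independent of the pair.\<close>
  define R' where "R' c c' \<longleftrightarrow> (\<exists>u\<in>?V. \<exists>v\<in>?V. colour u = c \<and> colour v = c' \<and>
    ?r < \<bar>f u - f v\<bar> \<and> sat2 G M \<eta> u v)" for c c'
  show ?thesis
  proof (rule layoutI[where col = colour and R = R'])
    show "finite (windows ?r b k \<Sigma>)" using fin(2) by (rule finite_windows)
    show "colour v \<in> windows ?r b k \<Sigma>" for v
      unfolding colour_def windows_def by (intro restrict_PiE_iff[THEN iffD2] ballI lab_range)
    show "(u, v) \<in> parcs (interpret_graph \<nu> \<eta> G M) \<longleftrightarrow> R' (colour u) (colour v)"
      if "u \<in> pverts (interpret_graph \<nu> \<eta> G M)" "v \<in> pverts (interpret_graph \<nu> \<eta> G M)"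
        "?r < \<bar>f u - f v\<bar>" for u v
    proof -
      have uv: "u \<in> ?V" "v \<in> ?V" "?r < \<bar>f u - f v\<bar>" using that by auto
      have "sat2 G M \<eta> u v \<longleftrightarrow> R' (colour u) (colour v)"
      proof
        assume "R' (colour u) (colour v)"
        then obtain u' v' where "u' \<in> ?V" "v' \<in> ?V" "colour u' = colour u" "colour v' = colour v"
          "?r < \<bar>f u' - f v'\<bar>" "sat2 G M \<eta> u' v'" unfolding R'_def by blast
        then show "sat2 G M \<eta> u v" using sat2[of u' v' u v] uv by blast
      qed (use uv in \<open>unfold R'_def, blast\<close>)
      then show ?thesis using that by simp
    qed
    show "inj_on f (pverts (interpret_graph \<nu> \<eta> G M))" using inj by (rule inj_on_subset) auto
  qed (use r in auto)
qed

text \<open>The copies of \<open>v\<close> occupy the \<open>K\<close> consecutive positions from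
  \<open>K * f v\<close> on, so the edges among them are short. Every other edge stays inside one
  copy, whose index the colour records. The \<open>+ 1\<close> in the new bound absorbs the copy
  indices, which differ by less than \<open>K\<close>.\<close>

lemma layout_copy_graph:
  assumes lay: "layout f b k G" and K: "1 \<le> K"
  shows "layout (\<lambda>(v, i). int K * f v + int i) (int K * (b + 1)) (k * K) (copy_graph K G)"
proof -
  let ?V = "pverts G" and ?g = "\<lambda>(v, i). int K * f v + int i"
  obtain col :: "'a \<Rightarrow> nat" and R where b: "0 \<le> b" and inj: "inj_on f ?V"
    and col: "\<And>v. v \<in> ?V \<Longrightarrow> col v < k"
    and far: "\<And>u v. u \<in> ?V \<Longrightarrow> v \<in> ?V \<Longrightarrow> b < \<bar>f u - f v\<bar> \<Longrightarrow>
       (u, v) \<in> parcs G \<longleftrightarrow> R (col u) (col v)"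
    using lay unfolding layout_def by blast
  show ?thesis
  proof (rule layoutI[where col = "\<lambda>(v, i). (col v, i)" and \<Gamma> = "{..<k} \<times> {..<K}"
        and R = "\<lambda>(c, i) (c', j). i = j \<and> R c c'"])
    show "inj_on ?g (pverts (copy_graph K G))"
    proof (rule inj_onI, clarsimp)
      fix u v i j assume V: "u \<in> ?V" "v \<in> ?V" and ij: "i < K" "j < K"
        and eq: "int K * f u + int i = int K * f v + int j"
      have "(int K * f u + int i) div int K = f u" "(int K * f v + int j) div int K = f v"
        using ij by simp_all
      then have "f u = f v" using eq by simp
      then show "u = v \<and> i = j" using eq V inj by (auto dest: inj_onD)
    qed
    fix p q assume p: "p \<in> pverts (copy_graph K G)" and q: "q \<in> pverts (copy_graph K G)"
      and d: "int K * (b + 1) < \<bar>?g p - ?g q\<bar>"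
    obtain u i v j where pq: "p = (u, i)" "q = (v, j)" by fastforce
    have V: "u \<in> ?V" "v \<in> ?V" "i < K" "j < K" using p q pq by auto
    have "b < \<bar>f u - f v\<bar>"
    proof (rule ccontr)
      assume "\<not> b < \<bar>f u - f v\<bar>"
      then have "\<bar>int K * (f u - f v)\<bar> \<le> int K * b" by (simp add: abs_mult mult_left_mono)
      moreover have "\<bar>int i - int j\<bar> \<le> int K" using V by linarith
      moreover have "?g p - ?g q = int K * (f u - f v) + (int i - int j)"
        by (simp add: pq algebra_simps)
      moreover have "int K * (b + 1) = int K * b + int K" by (simp add: algebra_simps)
      ultimately show False using d by linarith
    qed
    then have "u \<noteq> v" "(u, v) \<in> parcs G \<longleftrightarrow> R (col u) (col v)" using b far[OF V(1,2)] by auto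
    then show "(p, q) \<in> parcs (copy_graph K G) \<longleftrightarrow>
        (\<lambda>(c, i) (c', j). i = j \<and> R c c') ((\<lambda>(v, i). (col v, i)) p) ((\<lambda>(v, i). (col v, i)) q)"
      using V by (auto simp: pq)
  qed (use b K col in auto)
qed

lemma op_produces_layout:
  assumes "operation_ok t"
  shows "\<exists>K b' k'. 1 \<le> K \<and> (\<forall>G f H. pair_graph G \<and> layout f b k G \<and> op_produces t G H \<longrightarrow>
    (\<exists>g. layout g b' k' H \<and>
      (\<forall>v\<in>pverts H. \<exists>u\<in>pverts G. \<exists>i. 0 \<le> i \<and> i < K \<and> g v = K * f u + i)))"
proof (cases t)
  case (Copy c)
  have "\<exists>g. layout g (int c * (b + 1)) (k * c) H \<and>
      (\<forall>v\<in>pverts H. \<exists>u\<in>pverts G. \<exists>i. 0 \<le> i \<and> i < int c \<and> g v = int c * f u + i)"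
    if lay: "layout f b k G" and prod: "op_produces t G H" for G f H
  proof -
    obtain h where h: "iso_map h (copy_graph c G) H"
      using prod Copy by (auto simp: graph_iso_iff)
    let ?i = "the_inv_into (pverts (copy_graph c G)) h"
    have im: "?i v \<in> pverts G \<times> {..<c}" if "v \<in> pverts H" for v
      using that h the_inv_into_into[of h "pverts (copy_graph c G)" v]
      by (auto simp: iso_map_def bij_betw_def)
    have "\<exists>u\<in>pverts G. \<exists>i. 0 \<le> i \<and> i < int c \<and> (\<lambda>(v, i). int c * f v + int i) (?i v) = int c * f u + i"
      if "v \<in> pverts H" for v
    proof -
      obtain u i where "?i v = (u, i)" "u \<in> pverts G" "i < c" using im[OF \<open>v \<in> pverts H\<close>] by blast
      then show ?thesis by (intro bexI[of _ u] exI[of _ "int i"]) auto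
    qed
    then show ?thesis
      using layout_iso[OF h layout_copy_graph[OF lay]] assms Copy by auto
  qed
  moreover have "1 \<le> int c" using assms Copy by simp
  ultimately show ?thesis by blast
next
  case (NonCopying \<Sigma> \<nu> \<eta>)
  let ?r = "fo_radius b \<eta>"
  have "\<exists>g. layout g ?r (card (windows ?r b k \<Sigma>)) H \<and>
      (\<forall>v\<in>pverts H. \<exists>u\<in>pverts G. \<exists>i. 0 \<le> i \<and> i < 1 \<and> g v = 1 * f u + i)"
    if G: "pair_graph G" and lay: "layout f b k G" and prod: "op_produces t G H" for G f H
  proof -
    obtain M where "graph_iso (interpret_graph \<nu> \<eta> G M) H"
      using prod NonCopying by auto
    then obtain h where h: "iso_map h (interpret_graph \<nu> \<eta> G M) H"
      by (auto simp: graph_iso_iff)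
    let ?i = "the_inv_into (pverts (interpret_graph \<nu> \<eta> G M)) h"
    have "?i v \<in> pverts G" if "v \<in> pverts H" for v
      using that h the_inv_into_into[of h "pverts (interpret_graph \<nu> \<eta> G M)" v "pverts G"]
      unfolding iso_map_def bij_betw_def by auto
    moreover have "layout f ?r (card (windows ?r b k \<Sigma>)) (interpret_graph \<nu> \<eta> G M)"
      using assms NonCopying G by (intro layout_interpret_graph[OF lay])
        (auto simp: simple_interpretation_def pair_graph_iff)
    ultimately show ?thesis
      using layout_iso[OF h] by fastforce
  qed
  moreover have "1 \<le> (1::int)" by simp
  ultimately show ?thesis by blast
qed

text \<open>
  The new positions refine the old ones by a factor that depends on the transduction only, so widely
  separated blocks of positions remain separated.
\<close>

lemma produces_layout:
  assumes "transduction T"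
  shows "\<exists>K b' k'. 1 \<le> K \<and> (\<forall>G f H. pair_graph G \<and> layout f b k G \<and> produces T G H \<longrightarrow>
    (\<exists>g. layout g b' k' H \<and>
      (\<forall>v\<in>pverts H. \<exists>u\<in>pverts G. \<exists>i. 0 \<le> i \<and> i < K \<and> g v = K * f u + i)))"
  using assms
proof (induction T arbitrary: b k)
  case Nil
  have "\<exists>g. layout g b k H \<and>
      (\<forall>v\<in>pverts H. \<exists>u\<in>pverts G. \<exists>i. 0 \<le> i \<and> i < 1 \<and> g v = 1 * f u + i)"
    if lay: "layout f b k G" and prod: "produces [] G H" for G f H
  proof -
    obtain h where h: "iso_map h G H" using prod by (auto simp: graph_iso_iff)
    have "the_inv_into (pverts G) h v \<in> pverts G" if "v \<in> pverts H" for v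
      using that h the_inv_into_into[of h "pverts G" v "pverts G"]
      unfolding iso_map_def bij_betw_def by auto
    then show ?thesis using layout_iso[OF h lay] by fastforce
  qed
  moreover have "1 \<le> (1::int)" by simp
  ultimately show ?case by blast
next
  case (Cons t T)
  have ok: "operation_ok t" "transduction T" using Cons.prems by (auto simp: transduction_def)
  obtain K\<^sub>1 b\<^sub>1 k\<^sub>1 where 1: "1 \<le> K\<^sub>1" "\<And>G f H. pair_graph G \<Longrightarrow> layout f b k G \<Longrightarrow> op_produces t G H \<Longrightarrow>
    \<exists>g. layout g b\<^sub>1 k\<^sub>1 H \<and> (\<forall>v\<in>pverts H. \<exists>u\<in>pverts G. \<exists>i. 0 \<le> i \<and> i < K\<^sub>1 \<and> g v = K\<^sub>1 * f u + i)"
    using op_produces_layout[OF ok(1), of b k] by blast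
  obtain K\<^sub>2 b\<^sub>2 k\<^sub>2 where 2: "1 \<le> K\<^sub>2" "\<And>G f H. pair_graph G \<Longrightarrow> layout f b\<^sub>1 k\<^sub>1 G \<Longrightarrow> produces T G H \<Longrightarrow>
    \<exists>g. layout g b\<^sub>2 k\<^sub>2 H \<and> (\<forall>v\<in>pverts H. \<exists>u\<in>pverts G. \<exists>i. 0 \<le> i \<and> i < K\<^sub>2 \<and> g v = K\<^sub>2 * f u + i)"
    using Cons.IH[OF ok(2), of b\<^sub>1 k\<^sub>1] by blast
  have "\<exists>g. layout g b\<^sub>2 k\<^sub>2 H \<and>
      (\<forall>v\<in>pverts H. \<exists>u\<in>pverts G. \<exists>i. 0 \<le> i \<and> i < K\<^sub>2 * K\<^sub>1 \<and> g v = K\<^sub>2 * K\<^sub>1 * f u + i)"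
    if G: "pair_graph G" and lay: "layout f b k G" and prod: "produces (t # T) G H" for G f H
  proof -
    obtain K where K: "op_produces t G K" "produces T K H" using prod by auto
    obtain g where g: "layout g b\<^sub>1 k\<^sub>1 K"
      "\<And>v. v \<in> pverts K \<Longrightarrow> \<exists>u\<in>pverts G. \<exists>i. 0 \<le> i \<and> i < K\<^sub>1 \<and> g v = K\<^sub>1 * f u + i"
      using 1(2)[OF G lay K(1)] by blast
    obtain g' where g': "layout g' b\<^sub>2 k\<^sub>2 H"
      "\<And>v. v \<in> pverts H \<Longrightarrow> \<exists>u\<in>pverts K. \<exists>i. 0 \<le> i \<and> i < K\<^sub>2 \<and> g' v = K\<^sub>2 * g u + i"
      using 2(2)[OF op_produces_pair_graph[OF K(1) G ok(1)] g(1) K(2)] by blast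
    have "\<exists>u\<in>pverts G. \<exists>i. 0 \<le> i \<and> i < K\<^sub>2 * K\<^sub>1 \<and> g' v = K\<^sub>2 * K\<^sub>1 * f u + i" if v: "v \<in> pverts H" for v
    proof -
      obtain w j where w: "w \<in> pverts K" "0 \<le> j" "j < K\<^sub>2" "g' v = K\<^sub>2 * g w + j"
        using g'(2)[OF v] by blast
      obtain u i where u: "u \<in> pverts G" "0 \<le> i" "i < K\<^sub>1" "g w = K\<^sub>1 * f u + i"
        using g(2)[OF w(1)] by blast
      \<comment> \<open>The combined remainder is a two-digit number with digits
        \<open>i < K\<^sub>1\<close> and \<open>j < K\<^sub>2\<close>.\<close>
      have "K\<^sub>2 * (i + 1) \<le> K\<^sub>2 * K\<^sub>1" using u 2(1) by (intro mult_left_mono) auto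
      then have "K\<^sub>2 * i + j < K\<^sub>2 * K\<^sub>1" using w(3) by (simp add: algebra_simps)
      moreover have "0 \<le> K\<^sub>2 * i + j" using u(2) w(2) 2(1) by simp
      moreover have "g' v = K\<^sub>2 * K\<^sub>1 * f u + (K\<^sub>2 * i + j)" using w(4) u(4) by (simp add: algebra_simps)
      ultimately show ?thesis using u(1) by blast
    qed
    then show ?thesis using g'(1) by blast
  qed
  moreover have "1 \<le> K\<^sub>2 * K\<^sub>1" using 1(1) 2(1) mult_mono[of 1 K\<^sub>2 1 K\<^sub>1] by simp
  ultimately show ?case by blast
qed


section \<open>Perturbations, paths and bandwidth\<close>


lemma complement_in_simps [simp]:
  "pverts (complement_in S G) = pverts G"
  "(u, v) \<in> parcs (complement_in S G) \<longleftrightarrow> u \<in> pverts G \<and> v \<in> pverts G \<and> u \<noteq> v \<and>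
     ((u, v) \<in> parcs G \<longleftrightarrow> \<not> (u \<in> S \<and> v \<in> S))"
  by (auto simp: complement_in_def)

lemma pverts_fold_complement_in [simp]: "pverts (fold complement_in Ss G) = pverts G"
  by (induction Ss arbitrary: G) auto

lemma pair_graph_complement_in: "pair_graph G \<Longrightarrow> pair_graph (complement_in S G)"
  by (auto simp: pair_graph_iff)

lemma pair_graph_fold_complement_in: "pair_graph G \<Longrightarrow> pair_graph (fold complement_in Ss G)"
  by (induction Ss arbitrary: G) (auto intro: pair_graph_complement_in)

lemma complement_in_complement_in:
  assumes "pair_graph G" shows "complement_in S (complement_in S G) = G"
proof -
  have "parcs (complement_in S (complement_in S G)) = parcs G"
    using assms by (auto simp: pair_graph_iff)
  then show ?thesis by (intro pair_pre_digraph.equality) auto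
qed

text \<open>Undoing the involutions in reverse order is what later makes \<open>C\<close> and
  \<open>D\<close> perturbations of each other with the same sets.\<close>

lemma fold_complement_in_rev:
  "pair_graph G \<Longrightarrow> fold complement_in (rev Ss) (fold complement_in Ss G) = G"
  by (induction Ss arbitrary: G) (auto simp: complement_in_complement_in pair_graph_complement_in)

text \<open>
  Complementing \<open>A \<union> B\<close>, \<open>A\<close> and \<open>B\<close> for disjoint \<open>A\<close> and \<open>B\<close> flips exactly the pairs between \<open>A\<close> and
  \<open>B\<close>.
\<close>

lemma flip_colour_pairs:
  fixes col :: "'a \<Rightarrow> nat"
  assumes "pair_graph G" "distinct zs" "\<forall>(c, d)\<in>set zs. c \<le> d"
  shows "\<exists>Ss. length Ss \<le> 3 * length zs \<and> (\<forall>S\<in>set Ss. S \<subseteq> pverts G) \<and>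
    (\<forall>u\<in>pverts G. \<forall>v\<in>pverts G. u \<noteq> v \<longrightarrow> ((u, v) \<in> parcs (fold complement_in Ss G) \<longleftrightarrow>
       ((u, v) \<in> parcs G) \<noteq> ((min (col u) (col v), max (col u) (col v)) \<in> set zs)))"
  using assms(2,3)
proof (induction zs)
  case Nil
  show ?case by (intro exI[of _ "[]"]) auto
next
  case (Cons z zs)
  obtain c d where z: "z = (c, d)" by fastforce
  then have cd: "c \<le> d" and notin: "(c, d) \<notin> set zs" using Cons.prems by auto
  have "distinct zs" "\<forall>(c, d)\<in>set zs. c \<le> d" using Cons.prems by auto
  from Cons.IH[OF this] obtain Ss where Ss: "length Ss \<le> 3 * length zs" "\<forall>S\<in>set Ss. S \<subseteq> pverts G"
    and ad': "\<forall>u\<in>pverts G. \<forall>v\<in>pverts G. u \<noteq> v \<longrightarrow> ((u, v) \<in> parcs (fold complement_in Ss G) \<longleftrightarrow>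
       ((u, v) \<in> parcs G) \<noteq> ((min (col u) (col v), max (col u) (col v)) \<in> set zs))"
    by (elim exE conjE)
  have ad: "(u, v) \<in> parcs (fold complement_in Ss G) \<longleftrightarrow>
      ((u, v) \<in> parcs G) \<noteq> ((min (col u) (col v), max (col u) (col v)) \<in> set zs)"
    if "u \<in> pverts G" "v \<in> pverts G" "u \<noteq> v" for u v
    by (rule ad'[rule_format]) (fact that)+
  define A where "A c = {v \<in> pverts G. col v = c}" for c
  \<comment> \<open>Inside a single colour class one complementation suffices. Since
    \<open>(c, d)\<close> does not occur in \<open>zs\<close>, no pair of vertices is flipped
    twice.\<close>
  define Us where "Us = (if c = d then [A c] else [A c \<union> A d, A c, A d])"
  have flip: "(u, v) \<in> parcs (fold complement_in Us H) \<longleftrightarrow>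
      ((u, v) \<in> parcs H) \<noteq> ((min (col u) (col v), max (col u) (col v)) = (c, d))"
    if "u \<in> pverts G" "v \<in> pverts G" "u \<noteq> v" "pverts H = pverts G" for u v H
  proof (cases "c = d")
    case True
    then show ?thesis using that by (auto simp: Us_def A_def min_def max_def)
  next
    case False
    then show ?thesis using that cd by (auto simp: Us_def A_def min_def max_def)
  qed
  show ?case
  proof (intro exI[of _ "Ss @ Us"] conjI ballI impI)
    show "length (Ss @ Us) \<le> 3 * length (z # zs)" using Ss(1) by (simp add: Us_def)
    show "S \<subseteq> pverts G" if "S \<in> set (Ss @ Us)" for S
      using that Ss(2) by (auto simp: Us_def A_def split: if_splits)
    fix u v assume uv: "u \<in> pverts G" "v \<in> pverts G" "u \<noteq> v"
    show "(u, v) \<in> parcs (fold complement_in (Ss @ Us) G) \<longleftrightarrow>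
       ((u, v) \<in> parcs G) \<noteq> ((min (col u) (col v), max (col u) (col v)) \<in> set (z # zs))"
      using flip[OF uv, of "fold complement_in Ss G"] ad[OF uv] notin z
      by (cases "(min (col u) (col v), max (col u) (col v)) = (c, d)") simp_all
  qed
qed

text \<open>Flipping all pairs of colours related by \<open>R\<close> deletes every long edge and
  creates none. Pairs at short distance may be flipped too, but they stay short. There are at most
  \<open>k * k\<close> pairs of colours, each costing at most three complementations.\<close>

lemma layout_perturbation:
  assumes G: "pair_graph G" and lay: "layout f b k G"
  shows "\<exists>Ss. length Ss \<le> 3 * (k * k) \<and> (\<forall>S\<in>set Ss. S \<subseteq> pverts G) \<and>
    (\<forall>u v. (u, v) \<in> parcs (fold complement_in Ss G) \<longrightarrow> \<bar>f u - f v\<bar> \<le> b)"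
proof -
  let ?V = "pverts G"
  obtain col :: "'a \<Rightarrow> nat" and R where col: "\<And>v. v \<in> ?V \<Longrightarrow> col v < k"
    and far: "\<And>u v. u \<in> ?V \<Longrightarrow> v \<in> ?V \<Longrightarrow> b < \<bar>f u - f v\<bar> \<Longrightarrow>
       (u, v) \<in> parcs G \<longleftrightarrow> R (col u) (col v)"
    using lay unfolding layout_def by blast
  define Z where "Z = {(c, d). c < k \<and> d < k \<and> c \<le> d \<and> R c d}"
  have sub: "Z \<subseteq> {..<k} \<times> {..<k}" by (auto simp: Z_def)
  then have finZ: "finite Z" by (rule finite_subset) simp
  have cardZ: "card Z \<le> k * k" using card_mono[OF _ sub] by simp
  obtain zs where zs: "set zs = Z" "distinct zs" using finite_distinct_list[OF finZ] by blast
  then have len: "length zs \<le> k * k" using cardZ distinct_card by metis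
  have "\<forall>(c, d)\<in>set zs. c \<le> d" by (auto simp: zs(1) Z_def)
  from flip_colour_pairs[OF G zs(2) this, where col = col]
  obtain Ss where Ss: "length Ss \<le> 3 * length zs" "\<forall>S\<in>set Ss. S \<subseteq> ?V"
    and ad': "\<forall>u\<in>?V. \<forall>v\<in>?V. u \<noteq> v \<longrightarrow> ((u, v) \<in> parcs (fold complement_in Ss G) \<longleftrightarrow>
       ((u, v) \<in> parcs G) \<noteq> ((min (col u) (col v), max (col u) (col v)) \<in> set zs))"
    by (elim exE conjE)
  have ad: "(u, v) \<in> parcs (fold complement_in Ss G) \<longleftrightarrow>
      ((u, v) \<in> parcs G) \<noteq> ((min (col u) (col v), max (col u) (col v)) \<in> set zs)"
    if "u \<in> ?V" "v \<in> ?V" "u \<noteq> v" for u v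
    by (rule ad'[rule_format]) (fact that)+
  have "\<bar>f u - f v\<bar> \<le> b" if uv: "(u, v) \<in> parcs (fold complement_in Ss G)" for u v
  proof (rule ccontr)
    assume "\<not> \<bar>f u - f v\<bar> \<le> b"
    then have d: "b < \<bar>f u - f v\<bar>" "b < \<bar>f v - f u\<bar>" by auto
    have V: "u \<in> ?V" "v \<in> ?V" "u \<noteq> v"
      using uv pair_graph_fold_complement_in[OF G, of Ss] by (auto simp: pair_graph_iff)
    \<comment> \<open>\<open>Z\<close> lists colour pairs in increasing order only; the symmetry of
      \<open>G\<close> allows the ends to be swapped so that \<open>R\<close> is evaluated in that
      order.\<close>
    have "(u, v) \<in> parcs G \<longleftrightarrow> (v, u) \<in> parcs G" using G by (auto simp: pair_graph_iff)
    then have "(u, v) \<in> parcs G \<longleftrightarrow> (min (col u) (col v), max (col u) (col v)) \<in> set zs"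
      using far[OF V(1,2) d(1)] far[OF V(2,1) d(2)] col[OF V(1)] col[OF V(2)]
      by (cases "col u \<le> col v") (simp_all add: zs(1) Z_def)
    then show False using ad[OF V] uv by blast
  qed
  then show ?thesis using Ss len by (intro exI[of _ Ss]) auto
qed

section \<open>Distances in paths, and bandwidth as a linear arrangement\<close>

lemma path_graph_of_simps [simp]:
  "pverts (path_graph_of vs) = set vs"
  "parcs (path_graph_of vs) = {(vs ! i, vs ! j) | i j. i < length vs \<and> j < length vs \<and> (j = Suc i \<or> i = Suc j)}"
  by (auto simp: path_graph_of_def)

lemma pair_wf_path_graph_of: "pair_wf_digraph (path_graph_of vs)"
  by (auto simp: pair_wf_digraph_iff)

lemma path_graph_of_arcs:
  assumes "Suc i < length vs"
  shows "(vs ! i, vs ! Suc i) \<in> parcs (path_graph_of vs)" "(vs ! Suc i, vs ! i) \<in> parcs (path_graph_of vs)"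
  using assms by fastforce+

lemma awalk_path_graph_of_iff:
  "pre_digraph.awalk (with_proj (path_graph_of vs)) u p v \<longleftrightarrow>
     u \<in> set vs \<and> set p \<subseteq> parcs (path_graph_of vs) \<and> pcas u p v"
  by (simp add: pre_digraph.awalk_def cas_with_proj_eq)

lemma path_awalk_exists:
  assumes "i \<le> j" "j < length vs"
  shows "\<exists>p. pre_digraph.awalk (with_proj (path_graph_of vs)) (vs ! i) p (vs ! j) \<and> length p = j - i"
    and "\<exists>p. pre_digraph.awalk (with_proj (path_graph_of vs)) (vs ! j) p (vs ! i) \<and> length p = j - i"
proof -
  show "\<exists>p. pre_digraph.awalk (with_proj (path_graph_of vs)) (vs ! i) p (vs ! j) \<and> length p = j - i"
    using assms
  proof (induction i rule: inc_induct)
    case base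
    then show ?case by (intro exI[of _ "[]"]) (simp add: awalk_path_graph_of_iff)
  next
    case (step i)
    then obtain p where "pre_digraph.awalk (with_proj (path_graph_of vs)) (vs ! Suc i) p (vs ! j)"
      "length p = j - Suc i" by blast
    then show ?case
      using step.hyps assms(2)
      by (intro exI[of _ "(vs ! i, vs ! Suc i) # p"])
        (simp add: awalk_path_graph_of_iff path_graph_of_arcs del: path_graph_of_simps(2))
  qed
  show "\<exists>p. pre_digraph.awalk (with_proj (path_graph_of vs)) (vs ! j) p (vs ! i) \<and> length p = j - i"
    using assms
  proof (induction j rule: dec_induct)
    case base
    then show ?case by (intro exI[of _ "[]"]) (simp add: awalk_path_graph_of_iff)
  next
    case (step j)
    then obtain p where "pre_digraph.awalk (with_proj (path_graph_of vs)) (vs ! j) p (vs ! i)"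
      "length p = j - i" by auto
    then show ?case
      using step.hyps step.prems
      by (intro exI[of _ "(vs ! Suc j, vs ! j) # p"])
        (simp add: awalk_path_graph_of_iff path_graph_of_arcs del: path_graph_of_simps(2))
  qed
qed

lemma path_awalk_length:
  assumes "distinct vs" "pcas (vs ! i) p (vs ! j)" "set p \<subseteq> parcs (path_graph_of vs)"
    "i < length vs" "j < length vs"
  shows "\<bar>int i - int j\<bar> \<le> int (length p)"
  using assms(2-4)
proof (induction p arbitrary: i)
  case Nil
  then show ?case using assms(1,5) by (auto simp: nth_eq_iff_index_eq)
next
  case (Cons e p)
  then have "e \<in> parcs (path_graph_of vs)" by simp
  then obtain a c where e: "e = (vs ! a, vs ! c)" and ac: "a < length vs" "c < length vs" "c = Suc a \<or> a = Suc c"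
    by auto
  then have "a = i" using Cons.prems assms(1) by (auto simp: nth_eq_iff_index_eq)
  moreover have "\<bar>int c - int j\<bar> \<le> int (length p)"
    using Cons.prems ac e by (intro Cons.IH) auto
  ultimately show ?case using ac by auto
qed

text \<open>Trades walks for index differences, the form in which powers of paths are compared with
  layouts.\<close>

lemma subgraph_graph_power_iff:
  assumes "pair_wf_digraph G" "distinct vs"
  shows "subgraph (with_proj G) (with_proj (graph_power (path_graph_of vs) l)) \<longleftrightarrow>
    pverts G \<subseteq> set vs \<and> (\<forall>u v. (u, v) \<in> parcs G \<longrightarrow> u \<noteq> v) \<and>
    (\<forall>i<length vs. \<forall>j<length vs. (vs ! i, vs ! j) \<in> parcs G \<longrightarrow> \<bar>int i - int j\<bar> \<le> int l)"
    (is "_ \<longleftrightarrow> ?R")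
proof -
  let ?Q = "graph_power (path_graph_of vs) l"
  interpret P: pair_wf_digraph "path_graph_of vs" by (rule pair_wf_path_graph_of)
  have "pair_wf_digraph ?Q"
    using P.awalk_hd_in_verts P.awalk_last_in_verts
    by (auto simp: pair_wf_digraph_iff graph_power_def)
  then have "subgraph (with_proj G) (with_proj ?Q) \<longleftrightarrow> pverts G \<subseteq> set vs \<and> parcs G \<subseteq> parcs ?Q"
    using assms(1) by (auto simp: subgraph_def compatible_def wf_digraph_wp_iff graph_power_def)
  also have "\<dots> \<longleftrightarrow> ?R"
  proof (intro conj_cong iffI)
    assume V: "pverts G \<subseteq> set vs" and sub: "parcs G \<subseteq> parcs ?Q"
    have "\<bar>int i - int j\<bar> \<le> int l" if ij: "i < length vs" "j < length vs" "(vs ! i, vs ! j) \<in> parcs G" for i j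
    proof -
      obtain p where "pre_digraph.awalk (with_proj (path_graph_of vs)) (vs ! i) p (vs ! j)" "length p \<le> l"
        using sub ij(3) by (auto simp: graph_power_def)
      then show ?thesis
        using path_awalk_length[OF assms(2), of i p j] ij unfolding awalk_path_graph_of_iff by linarith
    qed
    moreover have "u \<noteq> v" if "(u, v) \<in> parcs G" for u v
      using sub that by (auto simp: graph_power_def)
    ultimately show "(\<forall>u v. (u, v) \<in> parcs G \<longrightarrow> u \<noteq> v) \<and>
      (\<forall>i<length vs. \<forall>j<length vs. (vs ! i, vs ! j) \<in> parcs G \<longrightarrow> \<bar>int i - int j\<bar> \<le> int l)" by blast
  next
    assume V: "pverts G \<subseteq> set vs" and *: "(\<forall>u v. (u, v) \<in> parcs G \<longrightarrow> u \<noteq> v) \<and>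
      (\<forall>i<length vs. \<forall>j<length vs. (vs ! i, vs ! j) \<in> parcs G \<longrightarrow> \<bar>int i - int j\<bar> \<le> int l)"
    show "parcs G \<subseteq> parcs ?Q"
    proof (rule subrelI)
      fix u v assume uv: "(u, v) \<in> parcs G"
      then have "u \<in> set vs" "v \<in> set vs" using assms(1) V by (auto simp: pair_wf_digraph_iff)
      then obtain i j where ij: "i < length vs" "j < length vs" "u = vs ! i" "v = vs ! j"
        by (metis in_set_conv_nth)
      then have d: "\<bar>int i - int j\<bar> \<le> int l" using * uv by blast
      have "\<exists>p. pre_digraph.awalk (with_proj (path_graph_of vs)) u p v \<and> length p \<le> l"
      proof (cases "i \<le> j")
        case True
        then obtain p where "pre_digraph.awalk (with_proj (path_graph_of vs)) u p v" "length p = j - i"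
          using path_awalk_exists(1)[of i j vs] ij by blast
        then show ?thesis using d True by (intro exI[of _ p]) auto
      next
        case False
        then obtain p where "pre_digraph.awalk (with_proj (path_graph_of vs)) u p v" "length p = i - j"
          using path_awalk_exists(2)[of j i vs] ij by auto
        then show ?thesis using d False by (intro exI[of _ p]) auto
      qed
      then show "(u, v) \<in> parcs ?Q" using * uv by (auto simp: graph_power_def)
    qed
  qed auto
  finally show ?thesis .
qed

text \<open>The path lists the vertices in the order of their positions. Distinct integers are at
  least one apart, so closing the gaps can only shorten edges.\<close>

lemma subgraph_path_powerI:
  fixes G :: ngraph
  assumes G: "pair_graph G" and inj: "inj_on f (pverts G)"
    and near: "\<And>u v. (u, v) \<in> parcs G \<Longrightarrow> \<bar>f u - f v\<bar> \<le> int l"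
  shows "\<exists>P\<in>path_graphs. subgraph (with_proj G) (with_proj (graph_power P l))"
proof -
  let ?V = "pverts G"
  have wf: "pair_wf_digraph G" and loop: "\<And>u v. (u, v) \<in> parcs G \<Longrightarrow> u \<noteq> v" and fin: "finite ?V"
    using G by (auto simp: pair_graph_iff pair_wf_digraph_iff)
  show ?thesis
  proof (cases "?V = {}")
    case True
    then have "parcs G = {}" using wf by (auto simp: pair_wf_digraph_iff)
    \<comment> \<open>Path graphs have at least one vertex, so the empty graph is placed in a
      one-vertex path.\<close>
    then have "subgraph (with_proj G) (with_proj (graph_power (path_graph_of [0]) l))"
      using True by (subst subgraph_graph_power_iff[OF wf]) auto
    moreover have "path_graph_of [0] \<in> path_graphs" unfolding path_graphs_def by fastforce
    ultimately show ?thesis by blast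
  next
    case False
    define xs where "xs = sorted_list_of_set (f ` ?V)"
    define vs where "vs = map (the_inv_into ?V f) xs"
    have xs: "set xs = f ` ?V" "sorted_wrt (<) xs" "distinct xs"
      using fin by (auto simp: xs_def)
    have set: "set vs = ?V" using inj by (force simp: vs_def xs(1) the_inv_into_f_f)
    have dist: "distinct vs"
      using xs inj by (auto simp: vs_def distinct_map intro: inj_on_the_inv_into)
    have f: "f (vs ! i) = xs ! i" if "i < length xs" for i
      using that xs(1) f_the_inv_into_f[OF inj, of "xs ! i"] by (simp add: vs_def) (metis nth_mem)
    have gap: "int (j - i) \<le> xs ! j - xs ! i" if "i \<le> j" "j < length xs" for i j
      using that
    proof (induction j rule: dec_induct)
      case (step j)
      have "xs ! j < xs ! Suc j" using xs(2) step.prems by (simp add: sorted_wrt_nth_less)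
      then show ?case using step by (auto simp: of_nat_diff)
    qed simp
    have "\<bar>int i - int j\<bar> \<le> int l"
      if "i < length vs" "j < length vs" "(vs ! i, vs ! j) \<in> parcs G" for i j
    proof -
      have len: "i < length xs" "j < length xs" using that by (auto simp: vs_def)
      have "\<bar>xs ! i - xs ! j\<bar> \<le> int l" using near[OF that(3)] f len by simp
      then show ?thesis using gap[of i j] gap[of j i] len by (cases "i \<le> j") (simp_all add: of_nat_diff)
    qed
    then have "subgraph (with_proj G) (with_proj (graph_power (path_graph_of vs) l))"
      using set loop by (subst subgraph_graph_power_iff[OF wf dist]) auto
    moreover have "path_graph_of vs \<in> path_graphs"
      using dist False set unfolding path_graphs_def by auto
    ultimately show ?thesis by blast
  qed
qed

lemma bandwidth_le:
  fixes G :: ngraph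
  assumes "pair_graph G" "inj_on f (pverts G)" "\<And>u v. (u, v) \<in> parcs G \<Longrightarrow> \<bar>f u - f v\<bar> \<le> int l"
  shows "bandwidth G \<le> l"
  unfolding bandwidth_def by (rule Least_le) (rule subgraph_path_powerI[OF assms])

lemma bandwidth_arrangement:
  fixes G :: ngraph
  assumes G: "pair_graph G" and l: "bandwidth G \<le> l"
  obtains vs where "vs \<noteq> []" "distinct vs" "pverts G \<subseteq> set vs"
    "\<And>i j. \<lbrakk>i < length vs; j < length vs; (vs ! i, vs ! j) \<in> parcs G\<rbrakk> \<Longrightarrow> \<bar>int i - int j\<bar> \<le> int l"
proof -
  have wf: "pair_wf_digraph G" and fin: "finite (pverts G)"
    using G by (auto simp: pair_graph_iff pair_wf_digraph_iff)
  \<comment> \<open>The \<open>LEAST\<close> defining bandwidth is meaningful once some power works;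
    the vertices, being natural numbers, serve as their own positions.\<close>
  have "\<exists>P\<in>path_graphs. subgraph (with_proj G) (with_proj (graph_power P (Max (pverts G))))"
  proof (rule subgraph_path_powerI[OF G, of int])
    fix u v assume "(u, v) \<in> parcs G"
    then have "u \<in> pverts G" "v \<in> pverts G" using wf by (auto simp: pair_wf_digraph_iff)
    then have "u \<le> Max (pverts G)" "v \<le> Max (pverts G)" using fin by auto
    then show "\<bar>int u - int v\<bar> \<le> int (Max (pverts G))" by linarith
  qed (simp add: inj_on_def)
  then have "\<exists>P\<in>path_graphs. subgraph (with_proj G) (with_proj (graph_power P (bandwidth G)))"
    unfolding bandwidth_def by (rule LeastI)
  then obtain vs where vs: "vs \<noteq> []" "distinct vs"
    "subgraph (with_proj G) (with_proj (graph_power (path_graph_of vs) (bandwidth G)))"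
    unfolding path_graphs_def by blast
  show thesis
  proof (rule that[OF vs(1,2)])
    show "pverts G \<subseteq> set vs" using vs(3) subgraph_graph_power_iff[OF wf vs(2)] by blast
    show "\<bar>int i - int j\<bar> \<le> int l"
      if "i < length vs" "j < length vs" "(vs ! i, vs ! j) \<in> parcs G" for i j
    proof -
      have "\<bar>int i - int j\<bar> \<le> int (bandwidth G)"
        using vs(3) subgraph_graph_power_iff[OF wf vs(2)] that by blast
      then show ?thesis using l by linarith
    qed
  qed
qed


section \<open>Components\<close>


text \<open>
  An edge of the path between different blocks shows that all vertices of the colour of its head that
  lie outside the block of its tail are neighbours of the tail.  Hence such a colour is rare, the
  path changes its block only a bounded number of times and meets a bounded number of blocks.
\<close>

lemma path_with_blocks_bounded:
  fixes vs :: "'a list" and \<beta> :: "'a \<Rightarrow> 'b" and col :: "'a \<Rightarrow> nat"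
  assumes vs: "distinct vs" "vs \<noteq> []"
    and block: "\<And>j. card {v \<in> set vs. \<beta> v = j} \<le> m"
    and col: "\<And>v. v \<in> set vs \<Longrightarrow> col v < k"
    and R: "\<And>u v. u \<in> set vs \<Longrightarrow> v \<in> set vs \<Longrightarrow> \<beta> u \<noteq> \<beta> v \<Longrightarrow>
      (u, v) \<in> parcs (path_graph_of vs) \<longleftrightarrow> R (col u) (col v)"
  shows "length vs \<le> (k * (m + 2) + 1) * m"
proof -
  define cls where "cls c = {v \<in> set vs. col v = c}" for c
  define X where "X = {i. Suc i < length vs \<and> \<beta> (vs ! i) \<noteq> \<beta> (vs ! Suc i)}"
  have finX: "finite X" by (rule finite_subset[of _ "{..<length vs}"]) (auto simp: X_def)
  have small: "card (cls (col (vs ! Suc i))) \<le> m + 2" if "i \<in> X" for i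
  proof -
    have i: "Suc i < length vs" "\<beta> (vs ! i) \<noteq> \<beta> (vs ! Suc i)" using that by (auto simp: X_def)
    then have "R (col (vs ! i)) (col (vs ! Suc i))"
      using R[of "vs ! i" "vs ! Suc i"] path_graph_of_arcs(1)[OF i(1)] by simp
    then have adj: "(vs ! i, v) \<in> parcs (path_graph_of vs)"
      if "v \<in> cls (col (vs ! Suc i))" "\<beta> v \<noteq> \<beta> (vs ! i)" for v
      using R[of "vs ! i" v] that i(1) by (auto simp: cls_def)
    \<comment> \<open>For \<open>i = 0\<close> the truncated \<open>i - 1\<close> names the vertex
      itself, which only enlarges the set. The summand 2 in \<open>m + 2\<close> counts these two
      candidates.\<close>
    have "v \<in> {vs ! Suc i, vs ! (i - 1)}" if "(vs ! i, v) \<in> parcs (path_graph_of vs)" for v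
      using that vs(1) i(1) by (auto simp: nth_eq_iff_index_eq)
    with adj have "cls (col (vs ! Suc i)) \<subseteq> {v \<in> set vs. \<beta> v = \<beta> (vs ! i)} \<union> {vs ! Suc i, vs ! (i - 1)}"
      by (auto simp: cls_def)
    then have "card (cls (col (vs ! Suc i))) \<le>
        card ({v \<in> set vs. \<beta> v = \<beta> (vs ! i)} \<union> {vs ! Suc i, vs ! (i - 1)})"
      by (rule card_mono[rotated]) simp
    also have "\<dots> \<le> card {v \<in> set vs. \<beta> v = \<beta> (vs ! i)} + card {vs ! Suc i, vs ! (i - 1)}"
      by (rule card_Un_le)
    also have "\<dots> \<le> m + 2" using block by (intro add_mono) (auto simp: card_insert_if)
    finally show ?thesis .
  qed
  define C where "C = {c. c < k \<and> card (cls c) \<le> m + 2}"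
  have finC: "finite C" and cardC: "card C \<le> k"
    using card_mono[of "{..<k}" C] by (auto simp: C_def)
  have fincls: "finite (cls c)" for c by (simp add: cls_def)
  \<comment> \<open>Each change of block is charged to its head; the heads are distinct and lie in
    the at most \<open>k\<close> rare colour classes.\<close>
  have "(\<lambda>i. vs ! Suc i) ` X \<subseteq> (\<Union>c\<in>C. cls c)"
    using small col by (auto simp: C_def cls_def X_def)
  moreover have "inj_on (\<lambda>i. vs ! Suc i) X"
    using vs(1) by (auto simp: inj_on_def X_def nth_eq_iff_index_eq)
  ultimately have "card X \<le> card (\<Union>c\<in>C. cls c)"
    using finC fincls by (intro card_inj_on_le[of "\<lambda>i. vs ! Suc i"]) auto
  also have "\<dots> \<le> (\<Sum>c\<in>C. card (cls c))" using finC by (rule card_UN_le)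
  also have "\<dots> \<le> card C * (m + 2)" using sum_bounded_above[of C "\<lambda>c. card (cls c)" "m + 2"] by (simp add: C_def)
  also have "\<dots> \<le> k * (m + 2)" using cardC by (rule mult_le_mono1)
  finally have cardX: "card X \<le> k * (m + 2)" .
  \<comment> \<open>A block met by the path is either the first one or entered by a change.\<close>
  define J where "J = insert (\<beta> (vs ! 0)) ((\<lambda>i. \<beta> (vs ! Suc i)) ` X)"
  have finJ: "finite J" using finX by (simp add: J_def)
  have "card J \<le> Suc (card X)"
    unfolding J_def by (rule card_insert_le_m1) (simp_all add: card_image_le[OF finX])
  then have cardJ: "card J \<le> k * (m + 2) + 1" using cardX by simp
  have "\<beta> (vs ! i) \<in> J" if "i < length vs" for i
    using that
  proof (induction i)
    case (Suc i)
    then show ?case by (cases "i \<in> X") (auto simp: J_def X_def)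
  qed (simp add: J_def)
  then have "\<beta> v \<in> J" if "v \<in> set vs" for v using that by (metis in_set_conv_nth)
  then have "set vs \<subseteq> (\<Union>j\<in>J. {v \<in> set vs. \<beta> v = j})" by auto
  then have "card (set vs) \<le> card (\<Union>j\<in>J. {v \<in> set vs. \<beta> v = j})"
    using finJ by (intro card_mono) auto
  also have "\<dots> \<le> (\<Sum>j\<in>J. card {v \<in> set vs. \<beta> v = j})" using finJ by (rule card_UN_le)
  also have "\<dots> \<le> card J * m" using sum_bounded_above[of J "\<lambda>j. card {v \<in> set vs. \<beta> v = j}" m] block by simp
  also have "\<dots> \<le> (k * (m + 2) + 1) * m" using cardJ by (rule mult_le_mono1)
  finally show ?thesis using vs(1) by (simp add: distinct_card)
qed

text \<open>A component occupies consecutive positions at the start of its own block of length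
  \<open>L\<close>, and every edge stays inside a component. So no edge is long, and one colour with
  the empty relation is enough. The distance bound \<open>n\<close> does not grow with
  \<open>L\<close>, which leaves \<open>L\<close> free for later.\<close>

lemma bounded_components_layout:
  assumes G: "pair_graph G" and small: "\<And>S. S \<in> pre_digraph.sccs_verts (with_proj G) \<Longrightarrow> card S \<le> n"
    and L: "0 < L" "int n \<le> L"
  shows "\<exists>f. layout f (int n) 1 G \<and> (\<forall>v\<in>pverts G. f v mod L < int n)"
proof -
  let ?V = "pverts G"
  interpret pair_graph G by (rule G)
  obtain idx :: "'a set \<Rightarrow> nat" where idx: "inj_on idx sccs_verts"
    using finite_imp_inj_to_nat_seg[OF finite_sccs_verts] by blast
  have sub: "S \<subseteq> ?V" if "S \<in> sccs_verts" for S using sccs_verts_subsets[OF that] by simp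
  have "\<exists>p. bij_betw p S {0..<card S}" if "S \<in> sccs_verts" for S
    using ex_bij_betw_finite_nat finite_subset[OF sub[OF that]] pair_finite_verts by blast
  then obtain pos where pos: "\<And>S. S \<in> sccs_verts \<Longrightarrow> bij_betw (pos S) S {0..<card S}" by metis
  have comp: "scc_of u \<in> sccs_verts" "u \<in> scc_of u" if "u \<in> ?V" for u
    using scc_of_in_sccs_verts in_scc_of_self that by auto
  have pos_less: "int (pos (scc_of u) u) < int n" if "u \<in> ?V" for u
    using bij_betwE[OF pos[OF comp(1)[OF that]]] comp(2)[OF that] small[OF comp(1)[OF that]] by fastforce
  have arc: "scc_of u = scc_of v" if "(u, v) \<in> parcs G" for u v
  proof -
    have uv: "u \<in> ?V" "v \<in> ?V" using that wellformed' by auto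
    have "u \<rightarrow>\<^sup>*\<^bsub>with_proj G\<^esub> v" using that by (intro reachable_adjI) simp
    then have "u \<in> scc_of v" by (rule scc_ofI_reachable)
    then show ?thesis using comp uv sccs_verts_disjoint by blast
  qed
  define f where "f u = L * int (idx (scc_of u)) + int (pos (scc_of u) u)" for u
  have mod: "f u mod L = int (pos (scc_of u) u)" and div: "f u div L = int (idx (scc_of u))"
    if "u \<in> ?V" for u
    using pos_less[OF that] L by (simp_all add: f_def)
  have "layout f (int n) 1 G"
    unfolding layout_def
  proof (intro conjI exI[of _ "\<lambda>_. 0"] exI[of _ "\<lambda>_ _. False"] ballI impI)
    show "inj_on f ?V"
    proof (rule inj_onI)
      fix u v assume uv: "u \<in> ?V" "v \<in> ?V" "f u = f v"
      then have "idx (scc_of u) = idx (scc_of v)" using div[of u] div[of v] by simp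
      then have eq: "scc_of u = scc_of v" using idx comp(1) uv by (auto dest: inj_onD)
      moreover have "pos (scc_of u) u = pos (scc_of v) v" using mod[of u] mod[of v] uv by simp
      ultimately show "u = v"
        using pos[OF comp(1)[OF uv(1)]] comp(2)[OF uv(1)] comp(2)[OF uv(2)]
        by (auto simp: bij_betw_def dest: inj_onD)
    qed
    fix u v assume uv: "u \<in> ?V" "v \<in> ?V" "int n < \<bar>f u - f v\<bar>"
    have "(u, v) \<notin> parcs G"
    proof
      assume "(u, v) \<in> parcs G"
      then have "f u - f v = int (pos (scc_of u) u) - int (pos (scc_of v) v)"
        using arc by (simp add: f_def)
      then show False using uv(3) pos_less[OF uv(1)] pos_less[OF uv(2)] by linarith
    qed
    then show "(u, v) \<in> parcs G \<longleftrightarrow> False" by simp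
  qed auto
  then show ?thesis using mod pos_less by auto
qed

lemma paths_transducible_imp_large_components:
  assumes D: "\<And>G. G \<in> D \<Longrightarrow> pair_graph G" and trans: "path_graphs \<sqsubseteq>\<^sub>F\<^sub>O D"
  shows "arbitrarily_large_components D"
proof (rule ccontr)
  assume "\<not> ?thesis"
  then obtain n where n: "\<And>G S. G \<in> D \<Longrightarrow> S \<in> pre_digraph.sccs_verts (with_proj G) \<Longrightarrow> card S \<le> n"
    unfolding arbitrarily_large_components_def by (meson nat_le_linear)
  obtain T where T: "transduction T" "\<And>P. P \<in> path_graphs \<Longrightarrow> \<exists>H\<in>D. produces T H P"
    using trans unfolding fo_transducible_def by blast
  obtain K b k where K: "1 \<le> K" and lay: "\<And>G f H. pair_graph G \<Longrightarrow> layout f (int n) 1 G \<Longrightarrow> produces T G H \<Longrightarrow>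
    \<exists>g. layout g b k H \<and> (\<forall>v\<in>pverts H. \<exists>u\<in>pverts G. \<exists>i. 0 \<le> i \<and> i < K \<and> g v = K * f u + i)"
    using produces_layout[OF T(1), of "int n" 1] by blast
  \<comment> \<open>The transduction turns the occupied part of a block into an interval of length
    \<open>K * n\<close>, and the spacing becomes \<open>K * L\<close>. This leaves gaps of at least
    \<open>K * (\<bar>b\<bar> + 1)\<close>, which exceeds \<open>b\<close>. The absolute value is
    taken because no sign of \<open>b\<close> has been established at this point.\<close>
  define L where "L = int n + \<bar>b\<bar> + 1"
  \<comment> \<open>By injectivity, an interval of \<open>K * n\<close> positions holds at most this
    many vertices.\<close>
  define m where "m = nat (K * int n)"
  \<comment> \<open>One vertex more than \<open>path_with_blocks_bounded\<close> permits.\<close>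
  define vs where "vs = [0..<Suc ((k * (m + 2) + 1) * m)]"
  have vs: "distinct vs" "vs \<noteq> []" by (auto simp: vs_def)
  then have "path_graph_of vs \<in> path_graphs" unfolding path_graphs_def by blast
  then obtain H where H: "H \<in> D" "produces T H (path_graph_of vs)" using T(2) by blast
  have "0 < L" "int n \<le> L" by (auto simp: L_def)
  then obtain f where f: "layout f (int n) 1 H" "\<And>v. v \<in> pverts H \<Longrightarrow> f v mod L < int n"
    using bounded_components_layout[OF D[OF H(1)] n[OF H(1)]] by blast
  obtain g where g: "layout g b k (path_graph_of vs)" and pos: "\<And>v. v \<in> set vs \<Longrightarrow>
      \<exists>u\<in>pverts H. \<exists>i. 0 \<le> i \<and> i < K \<and> g v = K * f u + i"
    using lay[OF D[OF H(1)] f(1) H(2)] by auto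
  have "\<exists>q r. g v = K * L * q + r \<and> 0 \<le> r \<and> r < K * int n" if v: "v \<in> set vs" for v
  proof -
    obtain u i where u: "u \<in> pverts H" "0 \<le> i" "i < K" "g v = K * f u + i" using pos[OF v] by blast
    have "0 \<le> f u mod L" using \<open>0 < L\<close> by simp
    then have "0 \<le> K * (f u mod L) + i" using K u by simp
    moreover have "K * (f u mod L + 1) \<le> K * int n" using f(2)[OF u(1)] K by (intro mult_left_mono) auto
    then have "K * (f u mod L) + i < K * int n" using u(3) by (simp add: algebra_simps)
    moreover have "f u = L * (f u div L) + f u mod L" by simp
    then have "g v = K * L * (f u div L) + (K * (f u mod L) + i)"
      unfolding u(4) by (metis distrib_left mult.assoc add.assoc)
    ultimately show ?thesis by blast
  qed
  then obtain \<beta> \<rho> where \<beta>: "\<And>v. v \<in> set vs \<Longrightarrow> g v = K * L * \<beta> v + \<rho> v \<and> 0 \<le> \<rho> v \<and> \<rho> v < K * int n"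
    by metis
  obtain col :: "nat \<Rightarrow> nat" and R where inj: "inj_on g (set vs)"
    and col: "\<And>v. v \<in> set vs \<Longrightarrow> col v < k"
    and far: "\<And>u v. u \<in> set vs \<Longrightarrow> v \<in> set vs \<Longrightarrow> b < \<bar>g u - g v\<bar> \<Longrightarrow>
       (u, v) \<in> parcs (path_graph_of vs) \<longleftrightarrow> R (col u) (col v)"
    using g unfolding layout_def path_graph_of_simps(1) by blast
  have "length vs \<le> (k * (m + 2) + 1) * m"
  proof (rule path_with_blocks_bounded[OF vs, of \<beta>])
    fix j
    have "g ` {v \<in> set vs. \<beta> v = j} \<subseteq> {K * L * j..<K * L * j + K * int n}" using \<beta> by fastforce
    then have "card {v \<in> set vs. \<beta> v = j} \<le> card {K * L * j..<K * L * j + K * int n}"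
      using inj by (intro card_inj_on_le[of g]) (auto intro: inj_on_subset)
    then show "card {v \<in> set vs. \<beta> v = j} \<le> m" by (simp add: m_def)
  next
    fix u v assume uv: "u \<in> set vs" "v \<in> set vs" "\<beta> u \<noteq> \<beta> v"
    have KL: "K * L = K * int n + K * (\<bar>b\<bar> + 1)" by (simp add: L_def algebra_simps)
    have "0 \<le> K * L" using K \<open>0 < L\<close> by simp
    have "K * L * 1 \<le> K * L * \<bar>\<beta> u - \<beta> v\<bar>"
      using uv(3) \<open>0 \<le> K * L\<close> by (intro mult_left_mono) auto
    then have "K * L \<le> \<bar>K * L * \<beta> u - K * L * \<beta> v\<bar>"
      using \<open>0 \<le> K * L\<close> by (metis abs_mult abs_of_nonneg mult.right_neutral right_diff_distrib)
    moreover have "1 * (\<bar>b\<bar> + 1) \<le> K * (\<bar>b\<bar> + 1)" using K by (intro mult_right_mono) auto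
    moreover have "b < \<bar>(x + r) - (y + s)\<bar>"
      if "c \<le> \<bar>x - y\<bar>" "1 * (\<bar>b\<bar> + 1) \<le> e" "c = d + e" "0 \<le> r" "r < d" "0 \<le> s" "s < d"
      for x y r s c d e :: int
      using that by (smt (verit))
    ultimately have "b < \<bar>g u - g v\<bar>"
      using \<beta>[OF uv(1)] \<beta>[OF uv(2)] KL by metis
    then show "(u, v) \<in> parcs (path_graph_of vs) \<longleftrightarrow> R (col u) (col v)" using far uv by blast
  qed (rule col)
  then show False by (simp add: vs_def)
qed

section \<open>Long induced paths in large components\<close>

lemma relpow_distance_le:
  fixes f :: "'a \<Rightarrow> int"
  assumes "\<And>u v. (u, v) \<in> E \<Longrightarrow> \<bar>f u - f v\<bar> \<le> l" and "(u, v) \<in> E ^^ n"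
  shows "\<bar>f u - f v\<bar> \<le> l * int n"
  using assms(2)
proof (induction n arbitrary: v)
  case (Suc n)
  then obtain w where "(u, w) \<in> E ^^ n" "(w, v) \<in> E" by auto
  then have "\<bar>f u - f w\<bar> \<le> l * int n" "\<bar>f w - f v\<bar> \<le> l" using Suc.IH assms(1) by auto
  then show ?case by (simp add: algebra_simps)
qed simp

text \<open>A chord or a repeated vertex would shorten a walk of minimal length;
  \<open>short\<close> treats both at once. The first \<open>N\<close> vertices of the walk are
  taken.\<close>

lemma shortest_path_induced:
  assumes G: "pair_graph G" and reach: "(u, v) \<in> parcs G ^^ n"
    and least: "\<And>n'. (u, v) \<in> parcs G ^^ n' \<Longrightarrow> n \<le> n'" and N: "N \<le> n"
  shows "\<exists>ws. distinct ws \<and> length ws = N \<and> set ws \<subseteq> pverts G \<and>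
    (\<forall>i<N. \<forall>j<N. (ws ! i, ws ! j) \<in> parcs G \<longleftrightarrow> j = Suc i \<or> i = Suc j)"
proof -
  let ?E = "parcs G"
  have sym: "(x, y) \<in> ?E \<longleftrightarrow> (y, x) \<in> ?E" and loop: "(x, x) \<notin> ?E" for x y
    using G by (auto simp: pair_graph_iff)
  obtain p where p: "p 0 = u" "p n = v" "\<And>i. i < n \<Longrightarrow> (p i, p (Suc i)) \<in> ?E"
    using reach unfolding relpow_fun_conv by blast
  have seg: "(p i, p j) \<in> ?E ^^ (j - i)" if "i \<le> j" "j \<le> n" for i j
    using that
  proof (induction j rule: dec_induct)
    case (step j)
    then show ?case using p(3)[of j] by (auto simp: Suc_diff_le)
  qed simp
  have short: "j \<le> Suc i" if ij: "i < j" "j \<le> n" and "(p i, p j) \<in> ?E \<or> p i = p j" for i j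
  proof -
    have 1: "(u, p i) \<in> ?E ^^ i" "(p j, v) \<in> ?E ^^ (n - j)" using seg[of 0 i] seg[of j n] ij p by auto
    from that(3) show ?thesis
    proof
      assume "(p i, p j) \<in> ?E"
      then have "(u, p j) \<in> ?E ^^ Suc i" using 1 by auto
      then have "(u, v) \<in> ?E ^^ (Suc i + (n - j))" using 1 unfolding relpow_add by blast
      then show ?thesis using least ij by fastforce
    next
      assume "p i = p j"
      then have "(u, v) \<in> ?E ^^ (i + (n - j))" using 1 unfolding relpow_add by auto
      then show ?thesis using least ij by fastforce
    qed
  qed
  have adj: "(p i, p j) \<in> ?E \<longleftrightarrow> j = Suc i" and neq: "p i \<noteq> p j" if "i < j" "j \<le> n" for i j
  proof -
    show "(p i, p j) \<in> ?E \<longleftrightarrow> j = Suc i" using short[OF that] p(3)[of i] that by auto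
    show "p i \<noteq> p j"
    proof
      assume eq: "p i = p j"
      then have "j = Suc i" using short[OF that] that by auto
      then show False using eq p(3)[of i] that loop by auto
    qed
  qed
  have "inj_on p {..<N}"
    using neq N by (intro linorder_inj_onI') auto
  then have "distinct (map p [0..<N])" by (simp add: distinct_map atLeast0LessThan)
  moreover have "p i \<in> pverts G" if "i < N" for i
    using p(3)[of i] that N G by (auto simp: pair_graph_iff)
  moreover have "(p i, p j) \<in> ?E \<longleftrightarrow> j = Suc i \<or> i = Suc j" if "i < N" "j < N" for i j
  proof (cases i j rule: linorder_cases)
    case less
    then show ?thesis using adj[of i j] that N by auto
  next
    case equal
    then show ?thesis using loop by simp
  next
    case greater
    then show ?thesis using adj[of j i] sym[of "p i" "p j"] that N by auto
  qed
  ultimately show ?thesis by (intro exI[of _ "map p [0..<N]"]) auto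
qed

text \<open>The extremes of \<open>card S\<close> distinct integers are at least
  \<open>card S - 1\<close> apart, and a walk advances by at most \<open>l\<close> per arc. So the
  first and the last vertex of \<open>S\<close> are at graph distance at least \<open>N\<close>, and
  a shortest walk between them contains the path.\<close>

lemma large_component_induced_path:
  fixes f :: "'a \<Rightarrow> int"
  assumes G: "pair_graph G" and inj: "inj_on f (pverts G)"
    and near: "\<And>u v. (u, v) \<in> parcs G \<Longrightarrow> \<bar>f u - f v\<bar> \<le> int l"
    and S: "S \<in> pre_digraph.sccs_verts (with_proj G)" and l: "0 < l" and large: "l * N < card S"
  shows "\<exists>ws. distinct ws \<and> length ws = N \<and> set ws \<subseteq> pverts G \<and>
    (\<forall>i<N. \<forall>j<N. (ws ! i, ws ! j) \<in> parcs G \<longleftrightarrow> j = Suc i \<or> i = Suc j)"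
proof -
  interpret pair_graph G by (rule G)
  have sub: "S \<subseteq> pverts G" using sccs_verts_subsets[OF S] by simp
  then have fin: "finite S" using pair_finite_verts finite_subset by blast
  have ne: "S \<noteq> {}" using large by auto
  have cardf: "card (f ` S) = card S" using inj sub by (intro card_image) (rule inj_on_subset)
  have "Min (f ` S) \<in> f ` S" "Max (f ` S) \<in> f ` S" using fin ne by simp_all
  then obtain u v where uv: "u \<in> S" "v \<in> S" "f u = Min (f ` S)" "f v = Max (f ` S)" by (metis imageE)
  have "f ` S \<subseteq> {f u..f v}" using fin uv by auto
  then have "card S \<le> nat (f v - f u + 1)" using card_mono[of "{f u..f v}" "f ` S"] cardf by simp
  then have dist: "int (l * N) \<le> \<bar>f u - f v\<bar>" using large by linarith
  have "u \<rightarrow>\<^sup>*\<^bsub>with_proj G\<^esub> v" using S uv by (auto simp: in_sccs_verts_conv_reachable)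
  then have "(u, v) \<in> (parcs G)\<^sup>*" using reachable_rtranclI[of "with_proj G"] by simp
  then obtain n0 where n0: "(u, v) \<in> parcs G ^^ n0" using rtrancl_imp_relpow by blast
  define n where "n = (LEAST n. (u, v) \<in> parcs G ^^ n)"
  have n: "(u, v) \<in> parcs G ^^ n" unfolding n_def using n0 by (rule LeastI)
  have least: "n \<le> n'" if "(u, v) \<in> parcs G ^^ n'" for n' unfolding n_def using that by (rule Least_le)
  have "int l * int N \<le> int l * int n" using relpow_distance_le[where f = f, OF near n] dist by simp
  then have "N \<le> n" using l by simp
  then show ?thesis using shortest_path_induced[OF G n least] by blast
qed

text \<open>Isomorphic graphs have equally many vertices, so finitely many types would bound the
  orders and with them the components.\<close>

lemma infinite_iso_types:
  assumes D: "\<And>G. G \<in> D \<Longrightarrow> pair_graph G" and large: "arbitrarily_large_components D"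
  shows "infinite (D // {(G, H). G \<in> D \<and> H \<in> D \<and> graph_iso G H})"
proof
  let ?r = "{(G, H). G \<in> D \<and> H \<in> D \<and> graph_iso G H}" and ?c = "\<lambda>G. card (pverts G)"
  assume fin: "finite (D // ?r)"
  have "finite (?c ` X)" if XD: "X \<in> D // ?r" for X
  proof -
    obtain G where X: "X = ?r `` {G}" using XD by (auto elim: quotientE)
    have "?c H = ?c G" if "H \<in> X" for H
    proof -
      have "graph_iso G H" using that X by auto
      then obtain h where "iso_map h G H" by (auto simp: graph_iso_iff)
      then show ?thesis unfolding iso_map_def by (metis bij_betw_same_card)
    qed
    then have "?c ` X \<subseteq> {?c G}" by auto
    then show ?thesis by (rule finite_subset) simp
  qed
  then have fin': "finite (\<Union>X\<in>D // ?r. ?c ` X)" using fin by blast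
  have "G \<in> ?r `` {G}" if "G \<in> D" for G
    using that D[OF that] graph_iso_refl[of G] by (auto simp: pair_graph_iff pair_wf_digraph_iff)
  then have "?c ` D \<subseteq> (\<Union>X\<in>D // ?r. ?c ` X)" unfolding quotient_def by blast
  then have "finite (?c ` D)" using fin' by (rule finite_subset)
  then obtain n where n: "\<And>G. G \<in> D \<Longrightarrow> ?c G \<le> n"
    by (meson finite_nat_set_iff_bounded_le imageI)
  obtain G S where GS: "G \<in> D" "S \<in> pre_digraph.sccs_verts (with_proj G)" "Suc n \<le> card S"
    using large unfolding arbitrarily_large_components_def by blast
  interpret pair_graph G by (rule D[OF GS(1)])
  have "S \<subseteq> pverts G" using sccs_verts_subsets[OF GS(2)] by simp
  then have "card S \<le> ?c G" using pair_finite_verts by (rule card_mono[rotated])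
  then show False using n[OF GS(1)] GS(3) by simp
qed


section \<open>Transductions to and from paths\<close>


lemma distinct_index:
  assumes "distinct vs"
  obtains idx :: "'a \<Rightarrow> nat" where "\<And>i. i < length vs \<Longrightarrow> idx (vs ! i) = i"
proof
  show "the_inv_into {..<length vs} ((!) vs) (vs ! i) = i" if "i < length vs" for i
    using that assms by (intro the_inv_into_f_f) (auto simp: inj_on_def nth_eq_iff_index_eq)
qed

section \<open>Elementary operations and perturbations as transductions\<close>

lemma op_produces_NonCopyingI:
  "expansion \<Sigma> G M \<Longrightarrow> interpret_graph \<nu> \<eta> G M = H \<Longrightarrow> op_produces (NonCopying \<Sigma> \<nu> \<eta>) G H"
  by (metis graph_iso_refl op_produces.simps(2) pair_wf_digraph_interpret_graph)

lemma produces_replicate: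
  assumes "\<And>i. i < k \<Longrightarrow> op_produces t (F i) (F (Suc i))" "pair_wf_digraph (F k)"
  shows "produces (replicate k t) (F 0) (F k)"
  using assms
proof (induction k arbitrary: F)
  case 0
  then show ?case by (simp add: graph_iso_refl)
next
  case (Suc k)
  have "produces (replicate k t) (F (Suc 0)) (F (Suc k))"
    using Suc.IH[of "\<lambda>i. F (Suc i)"] Suc.prems by simp
  then show ?case using Suc.prems(1)[of 0] by auto
qed

text \<open>On distinct vertices this is the exclusive or of adjacency and membership of both ends
  in the marked set; \<open>Eq 0 0\<close> keeps all vertices.\<close>

definition flip_op :: operation where
  "flip_op = NonCopying {0} (Eq 0 0) (Conj (Neg (Eq 0 1))
     (Conj (Neg (Conj (Adj 0 1) (Conj (Pred 0 0) (Pred 0 1))))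
       (Neg (Conj (Neg (Adj 0 1)) (Neg (Conj (Pred 0 0) (Pred 0 1)))))))"

definition induced_op :: operation where
  "induced_op = NonCopying {0} (Pred 0 0) (Adj 0 1)"

text \<open>The nested negations encode a disjunction: adjacent or with a common neighbour, that is,
  at distance one or two.\<close>

definition square_op :: operation where
  "square_op = NonCopying {} (Eq 0 0) (Conj (Neg (Eq 0 1))
     (Neg (Conj (Neg (Adj 0 1)) (Neg (Exists 2 (Conj (Adj 0 2) (Adj 2 1)))))))"

text \<open>Removes the edges with one end under each symbol; treating both orientations keeps the
  formula symmetric.\<close>

definition delete_op :: operation where
  "delete_op = NonCopying {0, 1} (Eq 0 0) (Conj (Adj 0 1)
     (Conj (Neg (Conj (Pred 0 0) (Pred 1 1))) (Neg (Conj (Pred 0 1) (Pred 1 0)))))"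

lemma pair_graph_sym: "pair_graph G \<Longrightarrow> (u, v) \<in> parcs G \<Longrightarrow> (v, u) \<in> parcs G"
  by (simp add: pair_graph_iff)

lemma pair_graph_irrefl: "pair_graph G \<Longrightarrow> (u, u) \<notin> parcs G"
  by (auto simp: pair_graph_iff)

lemma operations_ok: "operation_ok flip_op" "operation_ok induced_op" "operation_ok square_op"
  "operation_ok delete_op"
proof -
  show "operation_ok flip_op"
    unfolding flip_op_def operation_ok.simps simple_interpretation_def
    by (simp add: sat2_def) (meson pair_graph_sym)
  show "operation_ok induced_op"
    unfolding induced_op_def operation_ok.simps simple_interpretation_def
    by (simp add: sat2_def) (meson pair_graph_sym pair_graph_irrefl)
  show "operation_ok square_op"
    unfolding square_op_def operation_ok.simps simple_interpretation_def
    by (simp add: sat2_def insert_Diff_if) (meson pair_graph_sym)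
  show "operation_ok delete_op"
    unfolding delete_op_def operation_ok.simps simple_interpretation_def
    by (simp add: sat2_def) (meson pair_graph_sym pair_graph_irrefl)
qed

lemma flip_op_produces:
  assumes "pair_graph G" "S \<subseteq> pverts G"
  shows "op_produces flip_op G (complement_in S G)"
  unfolding flip_op_def
proof (rule op_produces_NonCopyingI[where M = "\<lambda>_. S"])
  show "interpret_graph (Eq 0 0) (Conj (Neg (Eq 0 1))
     (Conj (Neg (Conj (Adj 0 1) (Conj (Pred 0 0) (Pred 0 1))))
       (Neg (Conj (Neg (Adj 0 1)) (Neg (Conj (Pred 0 0) (Pred 0 1))))))) G (\<lambda>_. S) = complement_in S G"
    by (intro pair_pre_digraph.equality) (auto simp: complement_in_def sat1_def sat2_def)
qed (use assms in \<open>auto simp: expansion_def\<close>)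

lemma complement_in_empty: "pair_graph G \<Longrightarrow> complement_in {} G = G"
  by (intro pair_pre_digraph.equality) (auto simp: complement_in_def pair_graph_iff)

text \<open>A transduction has a fixed number of operations, so shorter perturbations are padded
  with complementations in the empty set.\<close>

lemma flips_produce:
  assumes "pair_graph H" "length Ss \<le> k" "\<forall>S\<in>set Ss. S \<subseteq> pverts H"
    "graph_iso (fold complement_in Ss H) G"
  shows "produces (replicate k flip_op) H G"
  using assms
proof (induction k arbitrary: H Ss)
  case (Suc k)
  show ?case
  proof (cases Ss)
    case Nil
    have "op_produces flip_op H H"
      using flip_op_produces[of H "{}"] Suc.prems(1) complement_in_empty[of H] by simp
    moreover have "produces (replicate k flip_op) H G" using Suc.IH[of H "[]"] Suc.prems Nil by simp
    ultimately show ?thesis by auto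
  next
    case (Cons S Us)
    have "op_produces flip_op H (complement_in S H)"
      using flip_op_produces[of H S] Suc.prems Cons by simp
    moreover have "produces (replicate k flip_op) (complement_in S H) G"
      using Suc.prems Cons pair_graph_complement_in by (intro Suc.IH[of _ Us]) auto
    ultimately show ?thesis by auto
  qed
qed auto

lemma perturbation_transducible:
  assumes "perturbation_of C D" "\<And>G. G \<in> D \<Longrightarrow> pair_graph G"
  shows "C \<sqsubseteq>\<^sub>F\<^sub>O D"
proof -
  obtain k where k: "\<And>G. G \<in> C \<Longrightarrow> \<exists>H\<in>D. \<exists>Ss. length Ss \<le> k \<and> (\<forall>S\<in>set Ss. S \<subseteq> pverts H) \<and>
        graph_iso (fold complement_in Ss H) G"
    using assms(1) unfolding perturbation_of_def by blast
  have "transduction (replicate k flip_op)" using operations_ok by (simp add: transduction_def)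
  moreover have "\<exists>H\<in>D. produces (replicate k flip_op) H G" if "G \<in> C" for G
    using k[OF that] flips_produce assms(2) by blast
  ultimately show ?thesis unfolding fo_transducible_def by blast
qed

section \<open>Powers of paths and their subgraphs\<close>

definition path_power :: "'a list \<Rightarrow> nat \<Rightarrow> 'a pair_pre_digraph" where
  "path_power vs l = \<lparr> pverts = set vs,
     parcs = {(vs ! i, vs ! j) | i j. i < length vs \<and> j < length vs \<and> i \<noteq> j \<and> \<bar>int i - int j\<bar> \<le> int l} \<rparr>"

lemma path_power_1: "path_power vs 1 = path_graph_of vs"
proof -
  have "i \<noteq> j \<and> \<bar>int i - int j\<bar> \<le> int 1 \<longleftrightarrow> j = Suc i \<or> i = Suc j" for i j by auto
  then show ?thesis unfolding path_power_def path_graph_of_def by simp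
qed

lemma pverts_path_power [simp]: "pverts (path_power vs l) = set vs"
  by (simp add: path_power_def)

lemma path_power_arc_iff:
  assumes "distinct vs" "i < length vs" "j < length vs"
  shows "(vs ! i, vs ! j) \<in> parcs (path_power vs l) \<longleftrightarrow> i \<noteq> j \<and> \<bar>int i - int j\<bar> \<le> int l"
proof
  assume "(vs ! i, vs ! j) \<in> parcs (path_power vs l)"
  then obtain i' j' where "vs ! i = vs ! i'" "vs ! j = vs ! j'" "i' < length vs" "j' < length vs"
    "i' \<noteq> j'" "\<bar>int i' - int j'\<bar> \<le> int l" by (auto simp: path_power_def)
  then show "i \<noteq> j \<and> \<bar>int i - int j\<bar> \<le> int l" using assms by (simp add: nth_eq_iff_index_eq)
qed (use assms in \<open>auto simp: path_power_def\<close>)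

lemma path_power_arcE:
  assumes "(u, v) \<in> parcs (path_power vs l)"
  obtains i j where "i < length vs" "j < length vs" "u = vs ! i" "v = vs ! j" "i \<noteq> j"
    "\<bar>int i - int j\<bar> \<le> int l"
  using assms by (auto simp: path_power_def)

lemma pair_graph_path_power: "pair_graph (path_power vs l)" if "distinct vs"
  unfolding pair_graph_iff
proof (intro conjI allI impI)
  fix u v assume "(u, v) \<in> parcs (path_power vs l)"
  then obtain i j where ij: "i < length vs" "j < length vs" "u = vs ! i" "v = vs ! j" "i \<noteq> j"
    "\<bar>int i - int j\<bar> \<le> int l" by (rule path_power_arcE)
  then show "u \<in> pverts (path_power vs l)" "v \<in> pverts (path_power vs l)" "u \<noteq> v"
    using that by (auto simp: nth_eq_iff_index_eq)
  show "(v, u) \<in> parcs (path_power vs l)"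
    unfolding ij(3,4) path_power_arc_iff[OF that ij(2,1)] using ij by auto
qed simp

text \<open>Two steps of at most \<open>l\<close> indices reach every index difference up to
  \<open>2 * l\<close>, so repeated squaring doubles the exponent each time.\<close>

lemma square_op_path_power:
  assumes vs: "distinct vs" and l: "0 < l"
  shows "op_produces square_op (path_power vs l) (path_power vs (2 * l))"
  unfolding square_op_def
proof (rule op_produces_NonCopyingI[where M = "\<lambda>_. {}"])
  let ?Q = "path_power vs l"
  have two: "(vs ! i, vs ! j) \<in> parcs ?Q \<or> (\<exists>w\<in>set vs. (vs ! i, w) \<in> parcs ?Q \<and> (w, vs ! j) \<in> parcs ?Q)
      \<longleftrightarrow> \<bar>int i - int j\<bar> \<le> int (2 * l)" (is "?L \<longleftrightarrow> ?R")
    if ij: "i < length vs" "j < length vs" "i \<noteq> j" for i j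
  proof
    assume ?L
    then show ?R
    proof (elim disjE bexE conjE)
      assume "(vs ! i, vs ! j) \<in> parcs ?Q"
      then show ?R using path_power_arc_iff[OF vs ij(1,2)] by auto
    next
      fix w assume "w \<in> set vs" and w: "(vs ! i, w) \<in> parcs ?Q" "(w, vs ! j) \<in> parcs ?Q"
      then obtain h where h: "h < length vs" "w = vs ! h" by (metis in_set_conv_nth)
      then have "\<bar>int i - int h\<bar> \<le> int l" "\<bar>int h - int j\<bar> \<le> int l"
        using w path_power_arc_iff[OF vs] ij by simp_all
      then show ?R by linarith
    qed
  next
    assume R: ?R
    show ?L
    proof (cases "\<bar>int i - int j\<bar> \<le> int l")
      case True
      then show ?thesis using path_power_arc_iff[OF vs ij(1,2)] ij(3) by simp
    next
      case False
      \<comment> \<open>The vertex \<open>l\<close> places after the earlier end lies strictly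
        before the later end, as the ends are more than \<open>l\<close> apart, and within
        \<open>l\<close> of it.\<close>
      define h where "h = (if i < j then i + l else j + l)"
      have h: "h < length vs" "i \<noteq> h" "h \<noteq> j" "\<bar>int i - int h\<bar> \<le> int l" "\<bar>int h - int j\<bar> \<le> int l"
        using False R ij l by (auto simp: h_def)
      then have "(vs ! i, vs ! h) \<in> parcs ?Q" "(vs ! h, vs ! j) \<in> parcs ?Q"
        using path_power_arc_iff[OF vs] ij by simp_all
      then show ?thesis using h(1) by auto
    qed
  qed
  let ?I = "interpret_graph (Eq 0 0) (Conj (Neg (Eq 0 1))
     (Neg (Conj (Neg (Adj 0 1)) (Neg (Exists 2 (Conj (Adj 0 2) (Adj 2 1))))))) ?Q (\<lambda>_. {})"
  have "parcs ?I = parcs (path_power vs (2 * l))"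
  proof (rule set_eqI)
    fix e :: "nat \<times> nat"
    obtain u v where e: "e = (u, v)" by fastforce
    show "e \<in> parcs ?I \<longleftrightarrow> e \<in> parcs (path_power vs (2 * l))"
    proof (cases "u \<in> set vs \<and> v \<in> set vs")
      case True
      then obtain i j where ij: "i < length vs" "j < length vs" "u = vs ! i" "v = vs ! j"
        by (metis in_set_conv_nth)
      have "e \<in> parcs ?I \<longleftrightarrow> u \<noteq> v \<and> ((u, v) \<in> parcs ?Q \<or> (\<exists>w\<in>set vs. (u, w) \<in> parcs ?Q \<and> (w, v) \<in> parcs ?Q))"
        using True by (auto simp: e sat1_def sat2_def)
      also have "\<dots> \<longleftrightarrow> i \<noteq> j \<and> \<bar>int i - int j\<bar> \<le> int (2 * l)"
        using two[OF ij(1,2)] vs ij by (auto simp: nth_eq_iff_index_eq)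
      finally show ?thesis using path_power_arc_iff[OF vs ij(1,2)] by (simp add: e ij)
    next
      case False
      then show ?thesis by (auto simp: e path_power_def)
    qed
  qed
  moreover have "pverts ?I = set vs" by (simp add: sat1_def)
  ultimately show "?I = path_power vs (2 * l)"
    by (intro pair_pre_digraph.equality) auto
qed (simp add: expansion_def)

text \<open>
  If no vertex of \<open>Q\<close> has two neighbours of the same colour, then the edges of \<open>Q\<close> between two given
  colours that have to be deleted can be marked at their ends of the first colour.
\<close>

lemma delete_ops_produce:
  fixes Q :: ngraph and col :: "nat \<Rightarrow> nat"
  assumes Q: "pair_graph Q" and E: "E \<subseteq> parcs Q" "\<And>u v. (u, v) \<in> E \<Longrightarrow> (v, u) \<in> E"
    and col: "\<And>v. v \<in> pverts Q \<Longrightarrow> col v < m"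
    and unique: "\<And>u v w. \<lbrakk>(u, v) \<in> parcs Q; (u, w) \<in> parcs Q; col v = col w\<rbrakk> \<Longrightarrow> v = w"
  shows "produces (replicate (m * m) delete_op) Q \<lparr> pverts = pverts Q, parcs = E \<rparr>"
proof -
  define zs where "zs = List.product [0..<m] [0..<m]"
  have zs: "length zs = m * m" "set zs = {..<m} \<times> {..<m}"
    by (auto simp: zs_def)
  \<comment> \<open>After \<open>n\<close> rounds exactly those unwanted edges are gone whose
    colours form one of the first \<open>n\<close> pairs, in either order.\<close>
  define F where "F n = \<lparr> pverts = pverts Q, parcs = {(u, v) \<in> parcs Q. (u, v) \<in> E \<or>
    (col u, col v) \<notin> set (take n zs) \<and> (col v, col u) \<notin> set (take n zs)} \<rparr>" for n
  have step: "op_produces delete_op (F n) (F (Suc n))" if n: "n < length zs" for n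
  proof -
    obtain c d where cd: "zs ! n = (c, d)" by fastforce
    then have ins: "set (take (Suc n) zs) = insert (c, d) (set (take n zs))"
      using n by (simp add: take_Suc_conv_app_nth)
    define A where "A = {u \<in> pverts Q. col u = c \<and> (\<exists>v. col v = d \<and> (u, v) \<in> parcs Q \<and> (u, v) \<notin> E)}"
    define B where "B = {v \<in> pverts Q. col v = d}"
    define M where "M s = (if s = (0::nat) then A else B)" for s
    have A: "u \<in> A \<and> v \<in> B \<longleftrightarrow> (u, v) \<notin> E \<and> (col u, col v) = (c, d)" if uv: "(u, v) \<in> parcs Q" for u v
    proof
      assume "u \<in> A \<and> v \<in> B"
      then obtain w where w: "col w = d" "(u, w) \<in> parcs Q" "(u, w) \<notin> E" "col u = c" "col v = d"
        unfolding A_def B_def by blast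
      then have "w = v" using unique[OF w(2) uv] by simp
      then show "(u, v) \<notin> E \<and> (col u, col v) = (c, d)" using w by simp
    next
      assume "(u, v) \<notin> E \<and> (col u, col v) = (c, d)"
      then show "u \<in> A \<and> v \<in> B" using uv Q by (auto simp: A_def B_def pair_graph_iff)
    qed
    have "op_produces (NonCopying {0, 1} (Eq 0 0) (Conj (Adj 0 1)
     (Conj (Neg (Conj (Pred 0 0) (Pred 1 1))) (Neg (Conj (Pred 0 1) (Pred 1 0)))))) (F n) (F (Suc n))"
    proof (rule op_produces_NonCopyingI[where M = M])
      show "expansion {0, 1} (F n) M" by (auto simp: expansion_def M_def A_def B_def F_def)
      let ?I = "interpret_graph (Eq 0 0) (Conj (Adj 0 1)
        (Conj (Neg (Conj (Pred 0 0) (Pred 1 1))) (Neg (Conj (Pred 0 1) (Pred 1 0))))) (F n) M"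
      have "(u, v) \<in> parcs ?I \<longleftrightarrow> (u, v) \<in> parcs (F (Suc n))" for u v
      proof (cases "(u, v) \<in> parcs Q")
        case True
        then have V: "u \<in> pverts Q" "v \<in> pverts Q" "(v, u) \<in> parcs Q"
          using Q by (auto simp: pair_graph_iff)
        have "(u, v) \<in> E \<longleftrightarrow> (v, u) \<in> E" using E(2) by blast
        moreover have "(u, v) \<in> parcs ?I \<longleftrightarrow>
            (u, v) \<in> parcs (F n) \<and> \<not> (u \<in> A \<and> v \<in> B) \<and> \<not> (v \<in> A \<and> u \<in> B)"
          using V by (auto simp: sat1_def sat2_def F_def M_def)
        ultimately show ?thesis
          unfolding A[OF True] A[OF V(3)] by (auto simp: F_def ins True)
      next
        case False
        then show ?thesis by (auto simp: sat2_def F_def)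
      qed
      then have "parcs ?I = parcs (F (Suc n))" by auto
      moreover have "pverts ?I = pverts (F (Suc n))" by (auto simp: F_def sat1_def)
      ultimately show "?I = F (Suc n)" by (intro pair_pre_digraph.equality) auto
    qed
    then show ?thesis by (simp add: delete_op_def)
  qed
  have F0: "F 0 = Q" by (intro pair_pre_digraph.equality) (auto simp: F_def)
  have "(u, v) \<in> E" if "(u, v) \<in> parcs (F (m * m))" for u v
    using that zs col Q by (auto simp: F_def pair_graph_iff)
  then have Fm: "F (m * m) = \<lparr> pverts = pverts Q, parcs = E \<rparr>"
    using E(1) by (intro pair_pre_digraph.equality) (auto simp: F_def)
  have "pair_wf_digraph (F (m * m))"
    using Q by (auto simp: F_def pair_graph_iff pair_wf_digraph_iff)
  then show ?thesis
    using produces_replicate[of "m * m" delete_op F] step zs(1) by (simp add: F0 Fm)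
qed

lemma induced_op_produces:
  fixes G :: ngraph
  assumes "pair_wf_digraph H" "pverts H \<subseteq> pverts G" "parcs H = {(u, v) \<in> parcs G. u \<in> pverts H \<and> v \<in> pverts H}"
  shows "op_produces induced_op G H"
  unfolding induced_op_def
proof (rule op_produces_NonCopyingI[where M = "\<lambda>_. pverts H"])
  show "interpret_graph (Pred 0 0) (Adj 0 1) G (\<lambda>_. pverts H) = H"
    using assms by (intro pair_pre_digraph.equality) (auto simp: sat1_def sat2_def)
qed (use assms in \<open>auto simp: expansion_def\<close>)

lemma bounded_bandwidth_transducible:
  assumes D: "\<And>G. G \<in> D \<Longrightarrow> pair_graph G" and b: "\<And>G. G \<in> D \<Longrightarrow> bandwidth G \<le> b"
  shows "D \<sqsubseteq>\<^sub>F\<^sub>O path_graphs"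
proof -
  \<comment> \<open>The exponent reached by \<open>b\<close> squarings; it dominates
    \<open>b\<close>.\<close>
  define l :: nat where "l = 2 ^ b"
  \<comment> \<open>The neighbours of a vertex lie among \<open>2 * l + 1\<close> consecutive
    indices, so their residues modulo \<open>m\<close> are distinct.\<close>
  define m where "m = 2 * l + 1"
  have bl: "b \<le> l" unfolding l_def by (rule less_imp_le[OF less_exp])
  define T where "T = replicate b square_op @ (replicate (m * m) delete_op @ [induced_op])"
  have T: "transduction [induced_op]" "transduction (replicate (m * m) delete_op @ [induced_op])" "transduction T"
    using operations_ok by (auto simp: T_def transduction_def)
  have "\<exists>P\<in>path_graphs. produces T P G" if G: "G \<in> D" for G
  proof -
    have pg: "pair_graph G" and wf: "pair_wf_digraph G"
      using D[OF G] by (auto simp: pair_graph_iff pair_wf_digraph_iff)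
    obtain vs where vs: "vs \<noteq> []" "distinct vs" "pverts G \<subseteq> set vs"
      and near: "\<And>i j. \<lbrakk>i < length vs; j < length vs; (vs ! i, vs ! j) \<in> parcs G\<rbrakk> \<Longrightarrow> \<bar>int i - int j\<bar> \<le> int b"
      using bandwidth_arrangement[OF pg b[OF G]] by blast
    have 1: "produces (replicate b square_op) (path_graph_of vs) (path_power vs l)"
      using produces_replicate[of b square_op "\<lambda>i. path_power vs (2 ^ i)"]
        square_op_path_power[OF vs(2)] pair_graph_path_power[OF vs(2)]
      by (simp add: l_def path_power_1[symmetric] pair_graph_iff pair_wf_digraph_iff)
    obtain idx where idx: "\<And>i. i < length vs \<Longrightarrow> idx (vs ! i) = i"
      using distinct_index[OF vs(2)] by blast
    \<comment> \<open>Path vertices outside \<open>G\<close> are still present as isolated vertices;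
      \<open>induced_op\<close> drops them at the end.\<close>
    have 2: "produces (replicate (m * m) delete_op) (path_power vs l) \<lparr> pverts = set vs, parcs = parcs G \<rparr>"
    proof -
      have "parcs G \<subseteq> parcs (path_power vs l)"
      proof (rule subrelI)
        fix u v assume uv: "(u, v) \<in> parcs G"
        then have "u \<in> set vs" "v \<in> set vs" "u \<noteq> v" using pg vs(3) by (auto simp: pair_graph_iff)
        then obtain i j where ij: "i < length vs" "j < length vs" "u = vs ! i" "v = vs ! j"
          by (metis in_set_conv_nth)
        then have "\<bar>int i - int j\<bar> \<le> int l" "i \<noteq> j" using near[of i j] uv bl \<open>u \<noteq> v\<close> by auto
        then show "(u, v) \<in> parcs (path_power vs l)" using path_power_arc_iff[OF vs(2)] ij by simp
      qed
      moreover have "v = w" if uv: "(u, v) \<in> parcs (path_power vs l)" and uw: "(u, w) \<in> parcs (path_power vs l)"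
        and c: "idx v mod m = idx w mod m" for u v w
      proof -
        obtain i j where ij: "i < length vs" "j < length vs" "u = vs ! i" "v = vs ! j"
          "\<bar>int i - int j\<bar> \<le> int l" using uv by (rule path_power_arcE)
        obtain i' h where ih: "i' < length vs" "h < length vs" "u = vs ! i'" "w = vs ! h"
          "\<bar>int i' - int h\<bar> \<le> int l" using uw by (rule path_power_arcE)
        have "i' = i" using ij ih vs(2) by (auto simp: nth_eq_iff_index_eq)
        then have "\<bar>int j - int h\<bar> < int m" using ij ih by (auto simp: m_def)
        moreover have "int m dvd int j - int h"
          using c ij ih idx by (simp add: mod_eq_dvd_iff[symmetric] zmod_int[symmetric])
        ultimately have "int j - int h = 0" using dvd_imp_le_int[of "int j - int h" "int m"] by fastforce
        then show "v = w" using ij ih by simp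
      qed
      moreover have "idx v mod m < m" for v by (simp add: m_def)
      moreover have "(v, u) \<in> parcs G" if "(u, v) \<in> parcs G" for u v
        using pg that by (auto simp: pair_graph_iff)
      ultimately show ?thesis
        using delete_ops_produce[of "path_power vs l" "parcs G" "\<lambda>v. idx v mod m" m]
          pair_graph_path_power[OF vs(2)] by simp
    qed
    have "op_produces induced_op \<lparr> pverts = set vs, parcs = parcs G \<rparr> G"
      using wf vs(3) by (intro induced_op_produces) (auto simp: pair_wf_digraph_iff)
    then have 3: "produces [induced_op] \<lparr> pverts = set vs, parcs = parcs G \<rparr> G"
      using graph_iso_refl[OF wf] by auto
    have "produces T (path_graph_of vs) G"
      unfolding T_def using produces_append[OF 1 produces_append[OF 2 3 T(1)] T(2)] .
    moreover have "path_graph_of vs \<in> path_graphs" using vs unfolding path_graphs_def by blast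
    ultimately show ?thesis by blast
  qed
  then show ?thesis using T(3) unfolding fo_transducible_def by blast
qed

lemma large_components_transduce_paths:
  assumes D: "\<And>G. G \<in> D \<Longrightarrow> pair_graph G" and b: "\<And>G. G \<in> D \<Longrightarrow> bandwidth G \<le> b"
    and large: "arbitrarily_large_components D"
  shows "path_graphs \<sqsubseteq>\<^sub>F\<^sub>O D"
proof -
  have "\<exists>G\<in>D. produces [induced_op] G P" if "P \<in> path_graphs" for P
  proof -
    obtain us where us: "P = path_graph_of us" "us \<noteq> []" "distinct us"
      using \<open>P \<in> path_graphs\<close> unfolding path_graphs_def by blast
    let ?N = "length us"
    \<comment> \<open>\<open>Suc b\<close> takes the place of \<open>b\<close> to have a positive
      bound on edge lengths, even for bandwidth 0.\<close>
    obtain G S where G: "G \<in> D" and S: "S \<in> pre_digraph.sccs_verts (with_proj G)"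
      and card: "Suc (Suc b * ?N) \<le> card S"
      using large unfolding arbitrarily_large_components_def by blast
    have pg: "pair_graph G" using D[OF G] .
    obtain vs where vs: "vs \<noteq> []" "distinct vs" "pverts G \<subseteq> set vs"
      and near: "\<And>i j. \<lbrakk>i < length vs; j < length vs; (vs ! i, vs ! j) \<in> parcs G\<rbrakk> \<Longrightarrow> \<bar>int i - int j\<bar> \<le> int b"
      using bandwidth_arrangement[OF pg b[OF G]] by blast
    obtain idx where "\<And>i. i < length vs \<Longrightarrow> idx (vs ! i) = i"
      using distinct_index[OF vs(2)] by blast
    then have idx: "idx v < length vs" "vs ! idx v = v" if "v \<in> set vs" for v
      using that by (auto simp: in_set_conv_nth)
    have "\<exists>ws. distinct ws \<and> length ws = ?N \<and> set ws \<subseteq> pverts G \<and>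
      (\<forall>i<?N. \<forall>j<?N. (ws ! i, ws ! j) \<in> parcs G \<longleftrightarrow> j = Suc i \<or> i = Suc j)"
    proof (rule large_component_induced_path[OF pg _ _ S, where f = "\<lambda>v. int (idx v)" and l = "Suc b"])
      show "inj_on (\<lambda>v. int (idx v)) (pverts G)"
        using idx(2) vs(3) by (intro inj_onI) (metis of_nat_eq_iff subsetD)
      fix u v assume uv: "(u, v) \<in> parcs G"
      then have "u \<in> set vs" "v \<in> set vs" using pg vs(3) by (auto simp: pair_graph_iff)
      then show "\<bar>int (idx u) - int (idx v)\<bar> \<le> int (Suc b)"
        using near[of "idx u" "idx v"] idx uv by fastforce
    qed (use card in auto)
    then obtain ws where ws: "distinct ws" "length ws = ?N" "set ws \<subseteq> pverts G"
      and adj: "\<And>i j. i < ?N \<Longrightarrow> j < ?N \<Longrightarrow> (ws ! i, ws ! j) \<in> parcs G \<longleftrightarrow> j = Suc i \<or> i = Suc j"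
      by blast
    have "op_produces induced_op G (path_graph_of ws)"
    proof (rule induced_op_produces)
      show "parcs (path_graph_of ws) =
          {(u, v) \<in> parcs G. u \<in> pverts (path_graph_of ws) \<and> v \<in> pverts (path_graph_of ws)}"
      proof (intro set_eqI iffI)
        fix e assume "e \<in> {(u, v) \<in> parcs G. u \<in> pverts (path_graph_of ws) \<and> v \<in> pverts (path_graph_of ws)}"
        then obtain u v where e: "e = (u, v)" "(u, v) \<in> parcs G" "u \<in> set ws" "v \<in> set ws" by auto
        then obtain i j where "i < length ws" "j < length ws" "u = ws ! i" "v = ws ! j"
          by (metis in_set_conv_nth)
        then show "e \<in> parcs (path_graph_of ws)" using e adj[of i j] ws(2) by auto
      qed (use adj ws(2) in auto)
    qed (use ws(3) pair_wf_path_graph_of in auto)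
    moreover have "graph_iso (path_graph_of ws) P"
    proof -
      have b1: "bij_betw ((!) ws) {..<?N} (set ws)" and b2: "bij_betw ((!) us) {..<?N} (set us)"
        using ws us by (auto intro: bij_betw_nth)
      \<comment> \<open>Vertices with the same index on the two paths are matched.\<close>
      define h where "h = (!) us \<circ> the_inv_into {..<?N} ((!) ws)"
      have h: "h (ws ! i) = us ! i" if "i < ?N" for i
        using b1 that by (simp add: h_def the_inv_into_f_f bij_betw_def)
      have idx_iff: "(xs ! i, xs ! j) \<in> parcs (path_graph_of xs) \<longleftrightarrow> j = Suc i \<or> i = Suc j"
        if "distinct xs" "i < length xs" "j < length xs" for xs :: "nat list" and i j
        using path_power_arc_iff[OF that, of 1] unfolding path_power_1 by auto
      have "bij_betw h (set ws) (set us)"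
        unfolding h_def using b1 b2 by (intro bij_betw_trans[OF bij_betw_the_inv_into])
      moreover have "(h u, h v) \<in> parcs (path_graph_of us) \<longleftrightarrow> (u, v) \<in> parcs (path_graph_of ws)"
        if uv: "u \<in> set ws" "v \<in> set ws" for u v
      proof -
        obtain i j where ij: "i < ?N" "j < ?N" "u = ws ! i" "v = ws ! j"
          using uv unfolding in_set_conv_nth ws(2) by blast
        then show ?thesis using h idx_iff[OF us(3)] idx_iff[OF ws(1)] ws(2) by simp
      qed
      ultimately have "iso_map h (path_graph_of ws) P"
        unfolding iso_map_def us(1) by (simp add: pair_wf_path_graph_of del: path_graph_of_simps(2))
      then show ?thesis by (auto simp: graph_iso_iff)
    qed
    ultimately have "produces [induced_op] G P" by auto
    then show ?thesis using G by blast
  qed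
  moreover have "transduction [induced_op]" using operations_ok by (simp add: transduction_def)
  ultimately show ?thesis unfolding fo_transducible_def by blast
qed

section \<open>Layouts of graphs transduced from paths, and the equivalence\<close>

lemma path_graph_layout:
  assumes "distinct vs"
  shows "\<exists>f. layout f 1 1 (path_graph_of vs)"
proof -
  obtain idx where idx: "\<And>i. i < length vs \<Longrightarrow> idx (vs ! i) = i"
    using distinct_index[OF assms] by blast
  have "layout (\<lambda>v. int (idx v)) 1 1 (path_graph_of vs)"
    unfolding layout_def
  proof (intro conjI exI[of _ "\<lambda>_. 0"] exI[of _ "\<lambda>_ _. False"] ballI impI)
    show "inj_on (\<lambda>v. int (idx v)) (pverts (path_graph_of vs))"
      using idx by (auto simp: inj_on_def in_set_conv_nth)
    show "(u, v) \<in> parcs (path_graph_of vs) \<longleftrightarrow> False" if "1 < \<bar>int (idx u) - int (idx v)\<bar>" for u v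
      using that idx by auto
  qed auto
  then show ?thesis by blast
qed

text \<open>All paths have layouts with the same two bounds, so the bounds obtained from the
  transduction serve the whole of \<open>C\<close>.\<close>

lemma path_transducible_layout:
  assumes "C \<sqsubseteq>\<^sub>F\<^sub>O path_graphs"
  shows "\<exists>b k. \<forall>G\<in>C. \<exists>g. layout g b k G"
proof -
  obtain T where T: "transduction T" "\<And>G. G \<in> C \<Longrightarrow> \<exists>P\<in>path_graphs. produces T P G"
    using assms unfolding fo_transducible_def by blast
  obtain b k where lay: "\<And>(G :: ngraph) f H. pair_graph G \<Longrightarrow> layout f 1 1 G \<Longrightarrow> produces T G H \<Longrightarrow> \<exists>g. layout g b k H"
    using produces_layout[OF T(1), of 1 1] by meson
  have "\<exists>g. layout g b k G" if G: "G \<in> C" for G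
  proof -
    obtain vs where vs: "distinct vs" "produces T (path_graph_of vs) G"
      using T(2)[OF G] unfolding path_graphs_def by blast
    have "pair_graph (path_graph_of vs)"
      using pair_graph_path_power[OF vs(1), of 1] by (simp only: path_power_1)
    then show ?thesis using lay path_graph_layout[OF vs(1)] vs(2) by blast
  qed
  then show ?thesis by blast
qed

theorem theorem1p8:
  fixes C :: "ngraph set"
  assumes "graph_class C"
  shows "(C \<sqsubseteq>\<^sub>F\<^sub>O path_graphs \<and> path_graphs \<sqsubseteq>\<^sub>F\<^sub>O C) \<longleftrightarrow>
    (\<exists>D. graph_class D \<and> bounded_bandwidth D \<and> arbitrarily_large_components D \<and>
         perturbation_of C D \<and> perturbation_of D C)"
proof
  have C: "pair_graph G" if "G \<in> C" for G using assms that by (auto simp: graph_class_def)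
  assume *: "C \<sqsubseteq>\<^sub>F\<^sub>O path_graphs \<and> path_graphs \<sqsubseteq>\<^sub>F\<^sub>O C"
  then obtain b k where "\<forall>G\<in>C. \<exists>g. layout g b k G" using path_transducible_layout by blast
  then obtain g where g: "\<And>G. G \<in> C \<Longrightarrow> layout (g G) b k G" by metis
  have "\<exists>Ss. length Ss \<le> 3 * (k * k) \<and> (\<forall>S\<in>set Ss. S \<subseteq> pverts G) \<and>
      (\<forall>u v. (u, v) \<in> parcs (fold complement_in Ss G) \<longrightarrow> \<bar>g G u - g G v\<bar> \<le> b)" if "G \<in> C" for G
    using layout_perturbation[OF C[OF that] g[OF that]] .
  then obtain Ss where Ss: "\<And>G. G \<in> C \<Longrightarrow> length (Ss G) \<le> 3 * (k * k)"
    "\<And>G. G \<in> C \<Longrightarrow> \<forall>S\<in>set (Ss G). S \<subseteq> pverts G"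
    and near: "\<And>G u v. G \<in> C \<Longrightarrow> (u, v) \<in> parcs (fold complement_in (Ss G) G) \<Longrightarrow> \<bar>g G u - g G v\<bar> \<le> b"
    by metis
  \<comment> \<open>Every graph of \<open>C\<close> contributes exactly its own perturbed version,
    so that both perturbation statements hold.\<close>
  define pert where "pert G = fold complement_in (Ss G) G" for G
  define D where "D = pert ` C"
  have pg: "pair_graph (pert G)" if "G \<in> C" for G
    unfolding pert_def by (intro pair_graph_fold_complement_in C that)
  then have D: "pair_graph H" if "H \<in> D" for H using that by (auto simp: D_def)
  have refl: "graph_iso G G" if "pair_graph G" for G :: ngraph
    using that by (intro graph_iso_refl) (auto simp: pair_graph_iff pair_wf_digraph_iff)
  have CD: "perturbation_of C D"
    unfolding perturbation_of_def
  proof (intro exI[of _ "3 * (k * k)"] ballI)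
    fix G assume G: "G \<in> C"
    have "graph_iso (fold complement_in (rev (Ss G)) (pert G)) G"
      unfolding pert_def fold_complement_in_rev[OF C[OF G]] by (rule refl[OF C[OF G]])
    then show "\<exists>H\<in>D. \<exists>Ss. length Ss \<le> 3 * (k * k) \<and> (\<forall>S\<in>set Ss. S \<subseteq> pverts H) \<and>
        graph_iso (fold complement_in Ss H) G"
      using Ss[OF G] G by (intro bexI[of _ "pert G"] exI[of _ "rev (Ss G)"]) (auto simp: D_def pert_def)
  qed
  have DC: "perturbation_of D C"
    unfolding perturbation_of_def
  proof (intro exI[of _ "3 * (k * k)"] ballI)
    fix H assume "H \<in> D"
    then obtain G where G: "G \<in> C" "H = pert G" by (auto simp: D_def)
    then have "graph_iso (fold complement_in (Ss G) G) H" using refl[OF pg[OF G(1)]] by (simp add: pert_def)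
    then show "\<exists>G\<in>C. \<exists>Ss. length Ss \<le> 3 * (k * k) \<and> (\<forall>S\<in>set Ss. S \<subseteq> pverts G) \<and>
        graph_iso (fold complement_in Ss G) H"
      using Ss[OF G(1)] G by blast
  qed
  have "bandwidth H \<le> nat b" if H: "H \<in> D" for H
  proof -
    obtain G where G: "G \<in> C" "H = pert G" using H by (auto simp: D_def)
    have "0 \<le> b" "inj_on (g G) (pverts H)" using g[OF G(1)] G(2) by (auto simp: layout_def pert_def)
    then show ?thesis
      using near[OF G(1)] by (intro bandwidth_le[OF D[OF H], of "g G"]) (auto simp: G(2) pert_def)
  qed
  then have "bounded_bandwidth D" unfolding bounded_bandwidth_def by blast
  moreover have "path_graphs \<sqsubseteq>\<^sub>F\<^sub>O D"
    using * perturbation_transducible[OF CD D] fo_transducible_trans by blast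
  then have large: "arbitrarily_large_components D"
    using paths_transducible_imp_large_components[OF D] by blast
  moreover have "graph_class D"
    unfolding graph_class_def using D infinite_iso_types[OF D large] by blast
  ultimately show "\<exists>D. graph_class D \<and> bounded_bandwidth D \<and> arbitrarily_large_components D \<and>
         perturbation_of C D \<and> perturbation_of D C"
    using CD DC by blast
next
  have C: "pair_graph G" if "G \<in> C" for G using assms that by (auto simp: graph_class_def)
  assume "\<exists>D. graph_class D \<and> bounded_bandwidth D \<and> arbitrarily_large_components D \<and>
         perturbation_of C D \<and> perturbation_of D C"
  then obtain D b where D: "\<And>G. G \<in> D \<Longrightarrow> pair_graph G" and b: "\<And>G. G \<in> D \<Longrightarrow> bandwidth G \<le> b"
    and large: "arbitrarily_large_components D"
    and CD: "perturbation_of C D" and DC: "perturbation_of D C"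
    unfolding graph_class_def bounded_bandwidth_def by blast
  have "C \<sqsubseteq>\<^sub>F\<^sub>O path_graphs"
    using perturbation_transducible[OF CD D] bounded_bandwidth_transducible[OF D b] fo_transducible_trans
    by blast
  \<comment> \<open>This is where \<open>perturbation_of D C\<close> enters: it ties each graph of
    \<open>D\<close> with a large component to some graph of \<open>C\<close>.\<close>
  moreover have "path_graphs \<sqsubseteq>\<^sub>F\<^sub>O C"
    using large_components_transduce_paths[OF D b large] perturbation_transducible[OF DC C] fo_transducible_trans
    by blast
  ultimately show "C \<sqsubseteq>\<^sub>F\<^sub>O path_graphs \<and> path_graphs \<sqsubseteq>\<^sub>F\<^sub>O C" by blast
qed

end
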